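(* Let $\mathcal H$ be a complex Hilbert space, $A\in\boldsymbol B(\mathcal H)$, $B\in\boldsymbol B_+(\mathcal H)$, and let $\alpha,\beta$ be distinct positive real numbers. Then the following are equivalent: (i) $A^*A\le B$ and $A^*B^sA=B^{s+1}$ for $s=\alpha,\beta$; (ii) $A$ is quasinormal and $B=|A|^2$ $(=A^*A)$.
   Context: $\boldsymbol B(\mathcal H)$ denotes bounded operators on $\mathcal H$, $\boldsymbol B_+(\mathcal H)$ the positive ones; $|A|=(A^*A)^{1/2}$. An operator $A\in\boldsymbol B(\mathcal H)$ is quasinormal if $A(A^*A)=(A^*A)A$. Powers $B^s$ ($s>0$) are defined by functional calculus; $\le$ is the operator order. *)

theory Defs
  imports "HOL-Analysis.Analysis" "HOL-Computational_Algebra.Polynomial"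
begin

class complex_inner = real_normed_vector +
  fixes scaleC :: "complex \<Rightarrow> 'a \<Rightarrow> 'a"
    and cinner :: "'a \<Rightarrow> 'a \<Rightarrow> complex"
  assumes scaleC_add_right: "scaleC a (x + y) = scaleC a x + scaleC a y"
    and scaleC_add_left: "scaleC (a + b) x = scaleC a x + scaleC b x"
    and scaleC_scaleC: "scaleC a (scaleC b x) = scaleC (a * b) x"
    and scaleC_one: "scaleC 1 x = x"
    and scaleC_of_real: "scaleC (of_real r) x = scaleR r x"
    and cinner_commute: "cinner x y = cnj (cinner y x)"
    and cinner_add_left: "cinner (x + y) z = cinner x z + cinner y z"
    and cinner_scaleC_left: "cinner (scaleC c x) y = cnj c * cinner x y"
    and cinner_self_real: "Im (cinner x x) = 0"
    and cinner_self_nonneg: "0 \<le> Re (cinner x x)"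
    and cinner_self_eq_zero: "cinner x x = 0 \<longleftrightarrow> x = 0"
    and norm_eq_sqrt_cinner: "norm x = sqrt (Re (cinner x x))"

class chilbert_space = complex_inner + complete_space

definition bounded_clinear :: "('a::complex_inner \<Rightarrow> 'b::complex_inner) \<Rightarrow> bool" where
  "bounded_clinear f \<longleftrightarrow>
     (\<forall>x y. f (x + y) = f x + f y) \<and> (\<forall>c x. f (scaleC c x) = scaleC c (f x)) \<and>
     (\<exists>K. \<forall>x. norm (f x) \<le> norm x * K)"

text \<open>Hilbert space adjoint (exists and is unique for bounded operators by Riesz).\<close>
definition adj :: "('a::chilbert_space \<Rightarrow> 'a) \<Rightarrow> ('a \<Rightarrow> 'a)" where
  "adj A = (SOME A'. \<forall>x y. cinner (A x) y = cinner x (A' y))"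

definition positive_op :: "('a::chilbert_space \<Rightarrow> 'a) \<Rightarrow> bool" where
  "positive_op B \<longleftrightarrow> bounded_clinear B \<and>
     (\<forall>x. Im (cinner (B x) x) = 0 \<and> 0 \<le> Re (cinner (B x) x))"

definition op_le :: "('a::chilbert_space \<Rightarrow> 'a) \<Rightarrow> ('a \<Rightarrow> 'a) \<Rightarrow> bool" where
  "op_le S T \<longleftrightarrow> positive_op (\<lambda>x. T x - S x)"

definition quasinormal :: "('a::chilbert_space \<Rightarrow> 'a) \<Rightarrow> bool" where
  "quasinormal A \<longleftrightarrow> A \<circ> (adj A \<circ> A) = (adj A \<circ> A) \<circ> A"

definition poly_op :: "real poly \<Rightarrow> ('a::chilbert_space \<Rightarrow> 'a) \<Rightarrow> ('a \<Rightarrow> 'a)" where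
  "poly_op p B = (\<lambda>x. \<Sum>i\<le>degree p. scaleC (of_real (coeff p i)) ((B ^^ i) x))"

text \<open>\<open>B^s\<close> via the continuous functional calculus: the norm limit of \<open>p_n(B)\<close> for any
  sequence of real polynomials \<open>p_n\<close> converging uniformly to \<open>t \<mapsto> t^s\<close> on
  \<open>[0, \<parallel>B\<parallel>]\<close> (which contains the spectrum of a positive operator \<open>B\<close>).\<close>
definition op_pow :: "('a::chilbert_space \<Rightarrow> 'a) \<Rightarrow> real \<Rightarrow> ('a \<Rightarrow> 'a)" where
  "op_pow B s = (THE T. bounded_clinear T \<and>
     (\<forall>ps :: nat \<Rightarrow> real poly.
        (\<forall>e>0. \<forall>\<^sub>F n in sequentially. \<forall>t\<in>{0..onorm B}. \<bar>poly (ps n) t - t powr s\<bar> < e)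
        \<longrightarrow> ((\<lambda>n. onorm (\<lambda>x. poly_op (ps n) B x - T x)) \<longlonglongrightarrow> 0)))"

end

theory Submission
  imports Defs "HOL-Computational_Algebra.Fundamental_Theorem_Algebra"
begin

text \<open>
  Let \<open>\<alpha> < \<beta>\<close>, \<open>q = 2 \<alpha> / \<beta> < 2\<close> and \<open>Y = B\<^bsup>\<beta>/2\<^esup>\<close>. For \<open>s \<ge> 0\<close> the function
  \<open>\<phi>\<^sub>s(u) = q u\<^sup>2 - 2 s\<^bsup>2-q\<^esup> u\<^bsup>q\<^esup> + (2 - q) s\<^sup>2\<close> lies between two positive multiples of
  \<open>(u - s)\<^sup>2\<close> that do not depend on \<open>s\<close>, by Young's inequality. The two power equations together
  with \<open>A\<^sup>*A \<le> B\<close> (the constant term of \<open>\<phi>\<^sub>s\<close> is nonnegative) give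
  \<open>A\<^sup>* \<phi>\<^sub>s(Y) A \<le> B \<phi>\<^sub>s(Y)\<close>, hence \<open>\<parallel>(Y - s) A h\<parallel> \<le> K \<parallel>(Y - s) h\<parallel>\<close> for all \<open>s\<close> and \<open>h\<close>.
  So \<open>A\<close> maps approximate eigenvectors of \<open>Y\<close> to approximate eigenvectors for the same value, and
  cutting \<open>h\<close> into spectral pieces shows that \<open>A\<close> commutes with \<open>Y\<close>, and therefore with \<open>B\<close>.
  Then \<open>D = B - A\<^sup>*A \<ge> 0\<close> satisfies \<open>D Y\<^sup>2 = 0\<close>, so \<open>B D = 0\<close>, and \<open>A\<^sup>*A \<le> B\<close> forces \<open>A D = 0\<close>; thus
  \<open>D\<^sup>2 = 0\<close> and \<open>D = 0\<close>.

  The functional calculus rests on the fact that a polynomial without zeros on \<open>[0, \<parallel>B\<parallel>]\<close> gives an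
  operator bounded below, which is checked on linear and quadratic factors. It makes \<open>p(B)\<close>
  positive when \<open>p \<ge> 0\<close> on \<open>[0, \<parallel>B\<parallel>]\<close>.
\<close>

section \<open>The real inner product and adjoints\<close>

text \<open>Working with the real part keeps all estimates in the real-linear setting of
  \<open>bounded_linear\<close>; \<open>cinner_eq_of_Re_eq\<close> recovers complex identities from
  it.\<close>

definition rinner :: "'a::complex_inner \<Rightarrow> 'a \<Rightarrow> real" where
  "rinner x y = Re (cinner x y)"

lemma rinner_commute: "rinner x y = rinner y x"
  unfolding rinner_def by (subst cinner_commute) simp

lemma rinner_add_left: "rinner (x + y) z = rinner x z + rinner y z"
  by (simp add: rinner_def cinner_add_left)

lemma rinner_scaleR_left: "rinner (c *\<^sub>R x) y = c * rinner x y"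
  by (simp add: rinner_def cinner_scaleC_left flip: scaleC_of_real)

lemma rinner_add_right: "rinner z (x + y) = rinner z x + rinner z y"
  by (metis rinner_commute rinner_add_left)

lemma rinner_scaleR_right: "rinner y (c *\<^sub>R x) = c * rinner y x"
  by (metis rinner_commute rinner_scaleR_left)

lemma rinner_diff_left: "rinner (x - y) z = rinner x z - rinner y z"
  by (metis add_diff_cancel_right' diff_add_cancel rinner_add_left)

lemma rinner_diff_right: "rinner z (x - y) = rinner z x - rinner z y"
  by (metis rinner_commute rinner_diff_left)

lemma rinner_zero [simp]: "rinner 0 x = 0" "rinner x 0 = 0"
  using rinner_scaleR_left[of 0 0 x] rinner_scaleR_right[of x 0 0] by auto

lemma rinner_self: "rinner x x = (norm x)\<^sup>2"
  by (simp add: rinner_def norm_eq_sqrt_cinner cinner_self_nonneg)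

lemma rinner_sum_left: "rinner (sum f I) y = (\<Sum>i\<in>I. rinner (f i) y)"
  by (induction I rule: infinite_finite_induct) (auto simp: rinner_add_left)

lemmas rinner_simps = rinner_add_left rinner_add_right rinner_diff_left rinner_diff_right
  rinner_scaleR_left rinner_scaleR_right

lemma rinner_eqI:
  assumes "\<And>y. rinner x y = rinner z y" shows "x = z"
proof -
  have "rinner (x - z) (x - z) = 0"
    by (simp add: rinner_diff_left assms)
  then show ?thesis by (simp add: rinner_self)
qed

text \<open>For \<open>a > 0\<close> evaluate at the vertex \<open>- b / a\<close>; for
  \<open>a = 0\<close> an affine function bounded below has slope 0. This is the core of
  Cauchy-Schwarz, kept separate because it is applied to several quadratics.\<close>

lemma discriminant_nonpos:
  fixes a b c :: real
  assumes "\<And>t. a * t\<^sup>2 + 2 * b * t + c \<ge> 0" and "a \<ge> 0"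
  shows "b\<^sup>2 \<le> a * c"
proof (cases "a = 0")
  case True
  have "b = 0"
  proof (rule ccontr)
    assume "b \<noteq> 0"
    \<comment> \<open>A nonzero slope would give the value -1 at this point.\<close>
    then show False using assms(1)[of "(- c - 1) / (2 * b)"] True by (simp add: field_simps)
  qed
  then show ?thesis using True by simp
next
  case False
  then have "a > 0" using assms by simp
  have "0 \<le> a * (a * (- b / a)\<^sup>2 + 2 * b * (- b / a) + c)"
    using assms(1)[of "- b / a"] assms(2) by (rule mult_nonneg_nonneg[rotated])
  also have "\<dots> = a * c - b\<^sup>2" using \<open>a > 0\<close> by (simp add: field_simps power2_eq_square)
  finally show ?thesis by simp
qed

lemma rinner_abs_le: "\<bar>rinner x y\<bar> \<le> norm x * norm y"
proof -
  have "(rinner x y)\<^sup>2 \<le> rinner x x * rinner y y"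
  proof (rule discriminant_nonpos)
    fix t
    have "0 \<le> rinner (t *\<^sub>R x + y) (t *\<^sub>R x + y)" by (simp add: rinner_self)
    also have "\<dots> = rinner x x * t\<^sup>2 + 2 * rinner x y * t + rinner y y"
      using rinner_commute[of x y] by (simp add: rinner_simps power2_eq_square algebra_simps)
    finally show "0 \<le> rinner x x * t\<^sup>2 + 2 * rinner x y * t + rinner y y" .
  qed (simp add: rinner_self)
  then have "(rinner x y)\<^sup>2 \<le> (norm x * norm y)\<^sup>2"
    by (simp add: rinner_self power_mult_distrib)
  then show ?thesis by (simp add: abs_le_square_iff[symmetric] abs_mult)
qed

lemma bounded_linear_rinner_left: "bounded_linear (\<lambda>x. rinner x y)"
  by (rule bounded_linear_intro[where K = "norm y"])
    (use rinner_abs_le in \<open>auto simp: rinner_simps\<close>)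

lemma bounded_clinear_imp_bounded_linear:
  assumes "bounded_clinear f"
  shows "bounded_linear f"
proof -
  obtain K where "\<And>x. norm (f x) \<le> norm x * K"
    using assms by (auto simp: bounded_clinear_def)
  then show ?thesis
    using assms by (intro bounded_linear_intro[where K = K])
      (auto simp: bounded_clinear_def simp flip: scaleC_of_real)
qed

text \<open>Riesz representation: the representing vector minimises \<open>\<parallel>x\<parallel>\<^sup>2 - 2 \<phi>(x)\<close>, and the
  parallelogram law makes minimising sequences Cauchy.\<close>

lemma riesz:
  fixes \<phi> :: "'a::chilbert_space \<Rightarrow> real"
  assumes "bounded_linear \<phi>"
  shows "\<exists>z. \<forall>x. \<phi> x = rinner x z"
proof -
  interpret bounded_linear \<phi> by fact
  obtain K where K: "\<And>x. norm (\<phi> x) \<le> norm x * K" using bounded by blast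
  define J where "J x = rinner x x - 2 * \<phi> x" for x
  have Jlow: "J x \<ge> - K\<^sup>2" for x
  proof -
    have "0 \<le> (norm x - K)\<^sup>2" by simp
    then have "2 * (norm x * K) \<le> (norm x)\<^sup>2 + K\<^sup>2" by (simp add: power2_diff)
    then show ?thesis using K[of x] unfolding J_def by (auto simp: abs_le_iff rinner_self)
  qed
  define m where "m = Inf (range J)"
  have bdd: "bdd_below (range J)" using Jlow by (auto intro!: bdd_belowI)
  have m: "m \<le> J x" for x unfolding m_def using bdd by (auto intro: cInf_lower)
  have "\<exists>x. J x < m + 1 / Suc n" for n :: nat
    using cInf_lessD[of "range J" "m + 1 / Suc n"] unfolding m_def by auto
  then obtain X where X: "\<And>n::nat. J (X n) < m + 1 / Suc n" by metis
  \<comment> \<open>The midpoint value of \<open>J\<close> is at least \<open>m\<close>, so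
    near-minimisers are close together.\<close>
  have par: "(norm (x - y))\<^sup>2 \<le> 2 * (J x - m) + 2 * (J y - m)" for x y
  proof -
    have "(norm (x - y))\<^sup>2 = 2 * J x + 2 * J y - 4 * J ((1/2) *\<^sub>R (x + y))"
      unfolding J_def using rinner_commute[of x y]
      by (simp add: rinner_simps scaleR add field_simps flip: rinner_self)
    then show ?thesis using m[of "(1/2) *\<^sub>R (x + y)"] by simp
  qed
  have "Cauchy X"
  proof (rule metric_CauchyI)
    fix e :: real assume "e > 0"
    \<comment> \<open>Two points with \<open>J\<close> within \<open>1 / N\<close> of
      \<open>m\<close> have squared distance below \<open>4 / N\<close> by
      \<open>par\<close>.\<close>
    obtain N :: nat where N: "4 / e\<^sup>2 < N" using reals_Archimedean2 by blast
    then have Npos: "real N > 0" using \<open>e > 0\<close>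
      by (meson divide_pos_pos order.strict_trans zero_less_numeral zero_less_power)
    show "\<exists>M. \<forall>i\<ge>M. \<forall>j\<ge>M. dist (X i) (X j) < e"
    proof (intro exI allI impI)
      fix i j assume "i \<ge> N" "j \<ge> N"
      have *: "J (X k) - m < 1 / N" if "k \<ge> N" for k
      proof -
        have "1 / Suc k \<le> 1 / N" using that Npos by (intro divide_left_mono) auto
        then show ?thesis using X[of k] by linarith
      qed
      have "(norm (X i - X j))\<^sup>2 < 4 / N"
        using par[of "X i" "X j"] *[OF \<open>i \<ge> N\<close>] *[OF \<open>j \<ge> N\<close>] by simp
      also have "\<dots> < e\<^sup>2" using N Npos \<open>e > 0\<close> by (simp add: field_simps)
      finally show "dist (X i) (X j) < e"
        using \<open>e > 0\<close> by (simp add: dist_norm power_less_imp_less_base)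
    qed
  qed
  then obtain z where z: "X \<longlonglongrightarrow> z" using Cauchy_convergent convergent_def by blast
  have "(\<lambda>n. J (X n)) \<longlonglongrightarrow> J z"
    unfolding J_def rinner_self using z by (intro tendsto_intros tendsto)
  moreover have "(\<lambda>n. m + 1 / Suc n) \<longlonglongrightarrow> m + 0"
    by (intro tendsto_intros LIMSEQ_Suc lim_1_over_n)
  ultimately have "J z \<le> m + 0"
    by (rule LIMSEQ_le) (use X in \<open>auto intro: less_imp_le\<close>)
  then have min: "J z \<le> J x" for x using m[of x] by simp
  have "\<phi> x = rinner x z" for x
  proof -
    \<comment> \<open>Along the line \<open>z + t x\<close> the excess of \<open>J\<close> over its
      minimum is a quadratic without constant term, so its linear coefficient must vanish.\<close>
    have "(rinner x z - \<phi> x)\<^sup>2 \<le> rinner x x * 0"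
    proof (rule discriminant_nonpos)
      fix t
      have "J (z + t *\<^sub>R x) - J z = rinner x x * t\<^sup>2 + 2 * (rinner x z - \<phi> x) * t + 0"
        unfolding J_def using rinner_commute[of x z]
        by (simp add: rinner_simps scaleR add power2_eq_square algebra_simps)
      then show "0 \<le> rinner x x * t\<^sup>2 + 2 * (rinner x z - \<phi> x) * t + 0"
        using min[of "z + t *\<^sub>R x"] by simp
    qed (simp add: rinner_self)
    then show ?thesis by simp
  qed
  then show ?thesis by blast
qed

text \<open>The form is conjugate-linear on the left, so replacing \<open>x\<close> by
  \<open>i x\<close> turns the imaginary part into a real part.\<close>

lemma cinner_eq_of_Re_eq:
  assumes "\<And>x. Re (cinner (f x) y) = Re (cinner x z)"
    and "\<And>c x. f (scaleC c x) = scaleC c (f x)"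
  shows "cinner (f x) y = cinner x z"
  using assms(1)[of x] assms(1)[of "scaleC \<i> x"]
  by (simp add: complex_eq_iff assms(2) cinner_scaleC_left)

text \<open>Riesz representation, applied for each \<open>y\<close>, supplies a witness for the
  \<open>SOME\<close> in \<open>adj\<close>.\<close>

lemma cinner_adj:
  fixes A :: "'a::chilbert_space \<Rightarrow> 'a"
  assumes "bounded_clinear A"
  shows "cinner (A x) y = cinner x (adj A y)"
proof -
  have "\<exists>z. \<forall>x. cinner (A x) y = cinner x z" for y
  proof -
    have "bounded_linear (\<lambda>x. rinner (A x) y)"
      using bounded_linear_compose[OF bounded_linear_rinner_left
          bounded_clinear_imp_bounded_linear[OF assms]] .
    from riesz[OF this] obtain z where "\<And>x. rinner (A x) y = rinner x z" by blast
    then show ?thesis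
      using assms cinner_eq_of_Re_eq[of A y z] by (auto simp: rinner_def bounded_clinear_def)
  qed
  then have "\<exists>A'. \<forall>x y. cinner (A x) y = cinner x (A' y)" by metis
  from someI_ex[OF this] show ?thesis unfolding adj_def by blast
qed

lemma rinner_adj:
  assumes "bounded_clinear A"
  shows "rinner (A x) y = rinner x (adj A y)" "rinner (adj A x) y = rinner x (A y)"
  using cinner_adj[OF assms] rinner_commute by (metis rinner_def)+

section \<open>Real polynomials and approximation\<close>

lemma map_poly_of_real_add:
  "map_poly of_real (p + q) = map_poly of_real p + map_poly of_real q"
  by (simp add: poly_eq_iff coeff_map_poly)

lemma map_poly_of_real_mult:
  "map_poly of_real (p * q) =
    (map_poly of_real p * map_poly of_real q :: 'a::{real_algebra_1, comm_ring_1} poly)"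
  by (simp add: poly_eq_iff coeff_map_poly coeff_mult)

lemma poly_map_poly_of_real:
  "poly (map_poly of_real p) (of_real x :: 'a::{real_algebra_1, comm_ring_1}) = of_real (poly p x)"
  by (induction p) (auto simp: map_poly_pCons)

text \<open>Take a complex root from the fundamental theorem of algebra. A real root gives a linear
  factor; a nonreal root, paired with its conjugate, gives \<open>(t - a)^2 + b^2\<close>.\<close>

lemma real_poly_linear_or_quadratic_factor:
  fixes p :: "real poly"
  assumes "degree p > 0"
  obtains a q where "p = [:- a, 1:] * q"
  | a b q where "b \<noteq> 0" "p = [:a\<^sup>2 + b\<^sup>2, - 2 * a, 1:] * q"
proof -
  let ?P = "map_poly complex_of_real p"
  have "degree ?P > 0" using assms by (simp add: degree_map_poly)
  then obtain z where z: "poly ?P z = 0"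
    using fundamental_theorem_of_algebra_alt[of ?P] by (metis degree_0 degree_pCons_0 less_irrefl)
  show ?thesis
  proof (cases "Im z = 0")
    case True
    then have "z = complex_of_real (Re z)" by (simp add: complex_eq_iff)
    then have "poly p (Re z) = 0" using z by (metis of_real_eq_0_iff poly_map_poly_of_real)
    then show ?thesis using that(1) by (auto simp: poly_eq_0_iff_dvd dvd_def)
  next
    case False
    \<comment> \<open>The minimal real polynomial of the nonreal number \<open>z\<close>.\<close>
    define Q where "Q = [:(Re z)\<^sup>2 + (Im z)\<^sup>2, - 2 * Re z, 1:]"
    have Qz: "poly (map_poly complex_of_real Q) z = 0"
      by (simp add: Q_def map_poly_pCons complex_eq_iff power2_eq_square algebra_simps)
    define r where "r = p mod Q"
    have "degree r < 2"
      using degree_mod_less[of Q p] by (auto simp: Q_def r_def)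
    then obtain a b where ab: "r = [:a, b:]"
      by (metis One_nat_def degree_pCons_eq_if less_2_cases_iff pCons_cases degree_eq_zeroE
          nat.inject numeral_2_eq_2 zero_less_Suc less_Suc_eq_0_disj pCons_0_0)
    have "p = Q * (p div Q) + r" by (simp add: r_def)
    then have "?P = map_poly complex_of_real Q * map_poly complex_of_real (p div Q)
        + map_poly complex_of_real r"
      by (metis map_poly_of_real_mult map_poly_of_real_add)
    then have "poly (map_poly complex_of_real r) z = 0" using z Qz by simp
    \<comment> \<open>A real polynomial of degree at most 1 that vanishes at a nonreal point is
      0.\<close>
    then have "b = 0" "a = 0" using False
      by (auto simp: ab map_poly_pCons complex_eq_iff)
    then have "p mod Q = 0" using ab by (simp add: r_def)
    then have "Q dvd p" by (simp add: mod_eq_0_iff_dvd)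
    then show ?thesis using that(2)[of "Im z" "Re z"] False by (auto simp: Q_def dvd_def)
  qed
qed


lemma weierstrass_poly:
  fixes f :: "real \<Rightarrow> real"
  assumes "continuous_on {a..b} f"
  shows "\<exists>ps. uniform_limit {a..b} (\<lambda>n. poly (ps n)) f sequentially"
proof -
  have ex: "\<exists>p. \<forall>t\<in>{a..b}. \<bar>poly p t - f t\<bar> < e" if "e > 0" for e
  proof -
    obtain g where g: "real_polynomial_function g" "\<And>t. t \<in> {a..b} \<Longrightarrow> \<bar>f t - g t\<bar> < e"
      using Stone_Weierstrass_real_polynomial_function[OF compact_Icc assms \<open>e > 0\<close>] by blast
    then obtain c n where c: "g = (\<lambda>x. \<Sum>i\<le>n. c i * x ^ i)"
      by (auto simp: real_polynomial_function_iff_sum)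
    have "poly (\<Sum>i\<le>n. monom (c i) i) t = g t" for t by (simp add: c poly_sum poly_monom)
    then show ?thesis using g(2)
      by (intro exI[of _ "\<Sum>i\<le>n. monom (c i) i"]) (simp add: abs_minus_commute)
  qed
  have "\<forall>n::nat. \<exists>p. \<forall>t\<in>{a..b}. \<bar>poly p t - f t\<bar> < 1 / Suc n" by (intro allI ex) simp
  then obtain ps where ps: "\<And>n::nat. \<forall>t\<in>{a..b}. \<bar>poly (ps n) t - f t\<bar> < 1 / Suc n"
    unfolding choice_iff by blast
  have "uniform_limit {a..b} (\<lambda>n. poly (ps n)) f sequentially"
  proof (rule uniform_limitI)
    fix e :: real assume "e > 0"
    then have "\<forall>\<^sub>F n in sequentially. 1 / Suc n < e"
      using order_tendstoD(2)[OF LIMSEQ_Suc[OF lim_1_over_n]] by simp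
    then show "\<forall>\<^sub>F n in sequentially. \<forall>t\<in>{a..b}. dist (poly (ps n) t) (f t) < e"
    proof eventually_elim
      case (elim n)
      then show ?case using ps[of n] unfolding dist_real_def by (meson less_trans)
    qed
  qed
  then show ?thesis by blast
qed

lemma continuous_on_powr_interval:
  "s > 0 \<Longrightarrow> continuous_on {0..L} (\<lambda>t::real. t powr s)"
  by (rule continuous_on_powr') (auto intro: continuous_intros)

section \<open>Polynomials of an operator\<close>

text \<open>Summing past the degree only adds zero coefficients; a common upper limit makes sums of
  polynomials comparable.\<close>

lemma poly_op_eq_sum:
  assumes "degree p \<le> n"
  shows "poly_op p B x = (\<Sum>i\<le>n. coeff p i *\<^sub>R (B ^^ i) x)"
proof -
  have "(\<Sum>i\<le>degree p. coeff p i *\<^sub>R (B ^^ i) x) = (\<Sum>i\<le>n. coeff p i *\<^sub>R (B ^^ i) x)"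
    by (rule sum.mono_neutral_left) (use assms in \<open>auto simp: coeff_eq_0\<close>)
  then show ?thesis by (simp add: poly_op_def scaleC_of_real)
qed

lemma poly_op_0 [simp]: "poly_op 0 B x = 0"
  using poly_op_eq_sum[of 0 0 B x] by simp

lemma poly_op_add: "poly_op (p + q) B x = poly_op p B x + poly_op q B x"
  using poly_op_eq_sum[of p "max (degree p) (degree q)" B x]
    poly_op_eq_sum[of q "max (degree p) (degree q)" B x]
    poly_op_eq_sum[of "p + q" "max (degree p) (degree q)" B x, OF degree_add_le_max]
  by (simp add: sum.distrib scaleR_add_left)

lemma poly_op_smult: "poly_op (smult c p) B x = c *\<^sub>R poly_op p B x"
  using poly_op_eq_sum[of p "degree p" B x] poly_op_eq_sum[of "smult c p" "degree p" B x]
  by (simp add: degree_smult_le scaleR_sum_right)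

lemma poly_op_diff: "poly_op (p - q) B x = poly_op p B x - poly_op q B x"
  using poly_op_add[of "p - q" q B x] by simp

lemma poly_op_pCons:
  assumes "bounded_linear B"
  shows "poly_op (pCons a p) B x = a *\<^sub>R x + B (poly_op p B x)"
proof -
  interpret bounded_linear B by fact
  have "poly_op (pCons a p) B x = (\<Sum>i\<le>Suc (degree p). coeff (pCons a p) i *\<^sub>R (B ^^ i) x)"
    by (rule poly_op_eq_sum) (simp add: degree_pCons_le)
  also have "\<dots> = a *\<^sub>R x + (\<Sum>i\<le>degree p. coeff p i *\<^sub>R B ((B ^^ i) x))"
    by (subst sum.atMost_Suc_shift) simp
  also have "\<dots> = a *\<^sub>R x + B (poly_op p B x)"
    by (simp add: poly_op_eq_sum[OF order.refl] sum scaleR)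
  finally show ?thesis .
qed

lemma poly_op_mult:
  assumes "bounded_linear B"
  shows "poly_op (p * q) B x = poly_op p B (poly_op q B x)"
  by (induction p arbitrary: x)
    (simp_all add: assms poly_op_pCons poly_op_add poly_op_smult mult_pCons_left)

lemma bounded_linear_poly_op:
  assumes "bounded_linear B"
  shows "bounded_linear (poly_op p B)"
proof (induction p)
  case 0
  then show ?case using bounded_linear_zero by (simp add: poly_op_0[abs_def])
next
  case (pCons a p)
  have "bounded_linear (\<lambda>x. a *\<^sub>R x + B (poly_op p B x))"
    by (intro bounded_linear_add bounded_linear_scaleR_right
        bounded_linear_compose[OF assms pCons.IH])
  moreover have "poly_op (pCons a p) B = (\<lambda>x. a *\<^sub>R x + B (poly_op p B x))"
    using poly_op_pCons[OF assms] by (rule ext)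
  ultimately show ?case by simp
qed

lemma poly_op_commute:
  assumes "bounded_linear B" "bounded_linear S" "\<And>x. S (B x) = B (S x)"
  shows "S (poly_op p B x) = poly_op p B (S x)"
proof -
  interpret S: bounded_linear S by fact
  show ?thesis by (induction p) (simp_all add: assms poly_op_pCons S.add S.scaleR S.zero)
qed

section \<open>Continuous functional calculus of a positive operator\<close>

text \<open>Polarisation: the quadratic form is real at \<open>x + i y\<close>, so the imaginary
  parts of its mixed terms cancel, and the factor \<open>i\<close> turns these into real
  parts.\<close>

lemma positive_op_rinner_swap:
  assumes "positive_op B"
  shows "rinner (B x) y = rinner x (B y)"
proof -
  have lin: "B (x + y) = B x + B y" "B (scaleC c x) = scaleC c (B x)" for c x y
    using assms by (auto simp: positive_op_def bounded_clinear_def)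
  have im: "Im (cinner (B x) x) = 0" for x
    using assms by (auto simp: positive_op_def)
  have add_right: "cinner z (x + y) = cinner z x + cinner z y" for x y z :: 'a
    by (metis cinner_add_left cinner_commute complex_cnj_add)
  have scale_right: "cinner z (scaleC c x) = c * cinner z x" for c and x z :: 'a
    by (metis cinner_commute cinner_scaleC_left complex_cnj_cnj complex_cnj_mult)
  have "Im (cinner (B x) (scaleC \<i> y)) + Im (cinner (B (scaleC \<i> y)) x) = 0"
    using im[of "x + scaleC \<i> y"] im[of x] im[of "scaleC \<i> y"]
    by (simp add: lin(1) cinner_add_left add_right)
  then have "Re (cinner (B x) y) = Re (cinner (B y) x)"
    by (simp add: lin(2) cinner_scaleC_left scale_right)
  then show ?thesis using rinner_commute by (metis rinner_def)
qed

locale pos_operator =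
  fixes B :: "'a::chilbert_space \<Rightarrow> 'a"
  assumes positive: "positive_op B"
begin

abbreviation M :: real where "M \<equiv> onorm B"

lemma blin: "bounded_linear B"
  using positive bounded_clinear_imp_bounded_linear by (auto simp: positive_op_def)

lemma sym: "rinner (B x) y = rinner x (B y)"
  by (rule positive_op_rinner_swap[OF positive])

lemma nonneg: "0 \<le> rinner (B x) x"
  using positive by (auto simp: positive_op_def rinner_def)

lemma M_nonneg: "0 \<le> M"
  by (rule onorm_pos_le[OF blin])

lemma norm_le_M: "norm (B x) \<le> M * norm x"
  by (rule onorm[OF blin])

section \<open>Lower bounds, positivity and norms for polynomials of a positive operator\<close>

lemmas blin_poly = bounded_linear_poly_op[OF blin]

lemma sym_poly: "rinner (poly_op p B x) y = rinner x (poly_op p B y)"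
proof (induction p arbitrary: x y)
  case (pCons a p)
  have "B (poly_op p B y) = poly_op p B (B y)"
    by (rule poly_op_commute[OF blin blin]) simp
  then show ?case
    using pCons.IH by (simp add: poly_op_pCons blin rinner_simps sym)
qed simp

text \<open>Induction on the degree, splitting off one real irreducible factor at a time. A root
  \<open>a < 0\<close> gives the bound \<open>- a\<close> by positivity, a root \<open>a > M\<close>
  gives \<open>a - M\<close> by the norm, and a quadratic factor gives \<open>b^2\<close>; lower
  bounds of composed operators multiply.\<close>

lemma poly_op_bounded_below:
  assumes "\<And>t. t \<in> {0..M} \<Longrightarrow> poly p t \<noteq> 0"
  shows "\<exists>d>0. \<forall>x. d * norm x \<le> norm (poly_op p B x)"
  using assms
proof (induction "degree p" arbitrary: p rule: less_induct)
  case less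
  show ?case
  proof (cases "degree p = 0")
    case True
    then obtain c where c: "p = [:c:]" by (rule degree_eq_zeroE)
    then have "c \<noteq> 0" using less.prems[of 0] M_nonneg by auto
    then show ?thesis
      by (intro exI[of _ "\<bar>c\<bar>"])
        (simp add: c poly_op_pCons blin linear_0[OF bounded_linear.linear[OF blin]])
  next
    case False
    have main: "\<exists>d>0. \<forall>x. d * norm x \<le> norm (poly_op p B x)"
      if p: "p = q1 * q" and deg: "degree q1 > 0"
        and d1: "d1 > 0" "\<And>x. d1 * norm x \<le> norm (poly_op q1 B x)" for q1 q d1
    proof -
      have "degree q < degree p" using False deg unfolding p
        by (subst degree_mult_eq) auto
      moreover have "\<And>t. t \<in> {0..M} \<Longrightarrow> poly q t \<noteq> 0" using less.prems p by auto
      ultimately obtain d2 where d2: "d2 > 0" "\<And>x. d2 * norm x \<le> norm (poly_op q B x)"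
        using less.hyps by blast
      have "d1 * d2 * norm x \<le> norm (poly_op p B x)" for x
      proof -
        have "d1 * (d2 * norm x) \<le> d1 * norm (poly_op q B x)"
          using d1 d2 by (intro mult_left_mono) auto
        also have "\<dots> \<le> norm (poly_op p B x)"
          unfolding p poly_op_mult[OF blin] by (rule d1)
        finally show ?thesis by (simp add: mult.assoc)
      qed
      then show ?thesis using d1 d2 by (intro exI[of _ "d1 * d2"]) auto
    qed
    \<comment> \<open>Cauchy-Schwarz turns a lower bound for the quadratic form into one for the
      norm.\<close>
    have lower: "c * norm x \<le> norm y" if "c * (norm x)\<^sup>2 \<le> rinner y x" for c and x y :: 'a
    proof (cases "x = 0")
      case False
      have "(c * norm x) * norm x \<le> norm y * norm x"
        using that rinner_abs_le[of y x] by (simp add: power2_eq_square mult.assoc)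
      then show ?thesis using False by simp
    qed simp
    interpret bounded_linear B by (rule blin)
    from False have "degree p > 0" by simp
    then show ?thesis
    proof (cases rule: real_poly_linear_or_quadratic_factor)
      case (1 a q)
      have ev: "poly_op [:- a, 1:] B x = B x - a *\<^sub>R x" for x
        by (simp add: poly_op_pCons blin zero)
      have "poly p a = 0" using 1 by simp
      then consider "a < 0" | "a > M" using less.prems[of a] by fastforce
      then show ?thesis
      proof cases
        case 1
        have "- a * norm x \<le> norm (poly_op [:- a, 1:] B x)" for x
          by (rule lower) (use nonneg[of x] in \<open>simp add: ev rinner_simps rinner_self\<close>)
        then show ?thesis using main[OF \<open>p = _\<close>, of "- a"] 1 by simp
      next
        case 2
        have "(a - M) * norm x \<le> norm (poly_op [:- a, 1:] B x)" for x
          using norm_triangle_ineq2[of "a *\<^sub>R x" "B x"] norm_le_M[of x] 2 M_nonneg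
          by (simp add: ev norm_minus_commute algebra_simps)
        then show ?thesis using main[OF \<open>p = _\<close>, of "a - M"] 2 by simp
      qed
    next
      case (2 a b q)
      have "b\<^sup>2 * norm x \<le> norm (poly_op [:a\<^sup>2 + b\<^sup>2, - 2 * a, 1:] B x)" for x
      proof (rule lower)
        have "rinner (poly_op [:a\<^sup>2 + b\<^sup>2, - 2 * a, 1:] B x) x
            = (norm (B x - a *\<^sub>R x))\<^sup>2 + b\<^sup>2 * (norm x)\<^sup>2"
          using sym[of x x] sym[of "B x" x]
          by (simp add: poly_op_pCons blin zero add diff scaleR rinner_simps power2_eq_square
              algebra_simps flip: rinner_self[unfolded power2_eq_square])
        then show "b\<^sup>2 * (norm x)\<^sup>2 \<le> rinner (poly_op [:a\<^sup>2 + b\<^sup>2, - 2 * a, 1:] B x) x"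
          by simp
      qed
      then show ?thesis using main[OF 2(2), of "b\<^sup>2"] 2(1) by simp
    qed
  qed
qed


text \<open>Let \<open>l\<close> be the infimum of the quadratic form on unit vectors. If
  \<open>l < 0\<close>, then \<open>p - l\<close> has no zero on \<open>{0..M}\<close>, so
  \<open>p(B) - l\<close> is bounded below by some \<open>d > 0\<close>. Being also a nonnegative
  form, it then stays above \<open>d^2 / k\<close> on unit vectors, which contradicts the choice of
  \<open>l\<close>.\<close>

lemma poly_op_nonneg:
  assumes "\<And>t. t \<in> {0..M} \<Longrightarrow> 0 \<le> poly p t"
  shows "0 \<le> rinner (poly_op p B x) x"
proof -
  let ?S = "poly_op p B"
  define V where "V = (\<lambda>x. rinner (?S x) x) ` {x. norm x = 1}"
  define l where "l = Inf V"
  have bnd: "\<bar>rinner (?S x) x\<bar> \<le> onorm ?S * (norm x)\<^sup>2" for x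
  proof -
    have "\<bar>rinner (?S x) x\<bar> \<le> norm (?S x) * norm x" by (rule rinner_abs_le)
    also have "\<dots> \<le> (onorm ?S * norm x) * norm x"
      by (intro mult_right_mono onorm blin_poly) auto
    finally show ?thesis by (simp add: power2_eq_square mult.assoc)
  qed
  have bdd: "bdd_below V"
  proof (rule bdd_belowI[of _ "- onorm ?S"])
    fix v assume "v \<in> V"
    then obtain x where "norm x = 1" "v = rinner (?S x) x" by (auto simp: V_def)
    then show "- onorm ?S \<le> v" using bnd[of x] by simp
  qed
  interpret S: bounded_linear ?S by (rule blin_poly)
  have hom: "c * (norm x)\<^sup>2 \<le> rinner (?S x) x" if "\<And>v. v \<in> V \<Longrightarrow> c \<le> v" for c x
  proof (cases "x = 0")
    case False
    define y where "y = (1 / norm x) *\<^sub>R x"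
    have "norm y = 1" using False by (simp add: y_def)
    then have "c \<le> rinner (?S y) y" using that by (auto simp: V_def)
    then show ?thesis using False
      by (simp add: y_def S.scaleR rinner_simps field_simps power2_eq_square)
  qed simp
  have l: "l * (norm x)\<^sup>2 \<le> rinner (?S x) x" for x
    by (rule hom) (use bdd in \<open>auto simp: l_def intro: cInf_lower\<close>)
  show ?thesis
  \<comment> \<open>Without unit vectors the infimum \<open>l\<close> carries no information, and
    \<open>hom\<close> applies vacuously with constant 0.\<close>
  proof (cases "l \<ge> 0 \<or> V = {}")
    case True
    then show ?thesis using l[of x] hom[of 0 x] order_trans[OF _ l[of x]] by auto
  next
    case False
    then have "l < 0" "V \<noteq> {}" by auto
    let ?T = "poly_op (p - [:l:]) B"
    have T: "?T x = ?S x - l *\<^sub>R x" for x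
      by (simp add: poly_op_diff poly_op_pCons blin linear_0[OF bounded_linear.linear[OF blin]])
    have "poly (p - [:l:]) t \<noteq> 0" if "t \<in> {0..M}" for t
      using assms[OF that] \<open>l < 0\<close> by simp
    from poly_op_bounded_below[OF this] obtain d where
      d: "d > 0" "\<And>x. d * norm x \<le> norm (?T x)" by blast
    interpret T: bounded_linear ?T by (rule blin_poly)
    have Tpos: "0 \<le> rinner (?T x) x" for x
      using l[of x] by (simp add: T rinner_simps rinner_self)
    \<comment> \<open>The summand 1 makes \<open>k\<close> strictly positive, as the later division
      requires.\<close>
    define k where "k = onorm ?T + 1"
    have k: "k > 0" using onorm_pos_le[OF T.bounded_linear_axioms] by (simp add: k_def)
    \<comment> \<open>Cauchy-Schwarz for the nonnegative form of \<open>T\<close>, applied to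
      \<open>x\<close> and \<open>T x\<close>; one factor of the squared norm of \<open>T x\<close>
      then cancels.\<close>
    have TT: "(norm (?T x))\<^sup>2 \<le> k * rinner (?T x) x" for x
    proof -
      have "(rinner (?T x) (?T x))\<^sup>2 \<le> rinner (?T x) x * rinner (?T (?T x)) (?T x)"
      proof (rule discriminant_nonpos)
        fix t
        have "rinner (?T (t *\<^sub>R x + ?T x)) (t *\<^sub>R x + ?T x)
           = rinner (?T x) x * t\<^sup>2 + 2 * rinner (?T x) (?T x) * t + rinner (?T (?T x)) (?T x)"
          using sym_poly[of "p - [:l:]" "?T x" x]
          by (simp add: T.add T.scaleR rinner_simps power2_eq_square algebra_simps)
        then show "0 \<le> rinner (?T x) x * t\<^sup>2 + 2 * rinner (?T x) (?T x) * t
            + rinner (?T (?T x)) (?T x)"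
          using Tpos by metis
      qed (rule Tpos)
      moreover have "rinner (?T (?T x)) (?T x) \<le> k * (norm (?T x))\<^sup>2"
      proof -
        have "rinner (?T (?T x)) (?T x) \<le> norm (?T (?T x)) * norm (?T x)"
          using rinner_abs_le[of "?T (?T x)" "?T x"] by simp
        also have "\<dots> \<le> (k * norm (?T x)) * norm (?T x)"
        proof (intro mult_right_mono)
          have "norm (?T (?T x)) \<le> onorm ?T * norm (?T x)"
            by (rule onorm[OF T.bounded_linear_axioms])
          then show "norm (?T (?T x)) \<le> k * norm (?T x)"
            by (simp add: k_def algebra_simps add_increasing)
        qed simp
        finally show ?thesis by (simp add: power2_eq_square mult.assoc)
      qed
      ultimately have "(rinner (?T x) (?T x))\<^sup>2 \<le> rinner (?T x) x * (k * (norm (?T x))\<^sup>2)"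
        using mult_left_mono[OF _ Tpos[of x]] by (meson order_trans)
      then have "(norm (?T x))\<^sup>2 * (norm (?T x))\<^sup>2 \<le> (k * rinner (?T x) x) * (norm (?T x))\<^sup>2"
        by (simp add: rinner_self power2_eq_square mult_ac)
      then show ?thesis using k Tpos[of x]
        by (cases "?T x = 0") (simp_all only: mult_le_cancel_right, auto)
    qed
    have "l + d\<^sup>2 / k \<le> v" if v: "v \<in> V" for v
    proof -
      obtain x where x: "norm x = 1" "v = rinner (?S x) x" using v by (auto simp: V_def)
      have "d\<^sup>2 \<le> (norm (?T x))\<^sup>2" using d(1) d(2)[of x] x by (intro power_mono) auto
      also have "\<dots> \<le> k * (v - l)" using TT[of x] x by (simp add: T rinner_simps rinner_self)
      finally show ?thesis using k by (simp add: field_simps)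
    qed
    then have "l + d\<^sup>2 / k \<le> l" unfolding l_def using \<open>V \<noteq> {}\<close> by (intro cInf_greatest)
    then show ?thesis using d k by (simp add: field_simps)
  qed
qed

text \<open>Positivity is applied to \<open>e^2 - p^2\<close>, and symmetry of \<open>p(B)\<close>
  turns the form of \<open>p(B)^2\<close> into a squared norm.\<close>

lemma norm_poly_op_le:
  assumes "\<And>t. t \<in> {0..M} \<Longrightarrow> \<bar>poly p t\<bar> \<le> e"
  shows "norm (poly_op p B x) \<le> e * norm x"
proof -
  have "0 \<le> e" using assms[of 0] M_nonneg by auto
  have "0 \<le> rinner (poly_op ([:e\<^sup>2:] - p * p) B x) x"
  proof (rule poly_op_nonneg)
    fix t assume "t \<in> {0..M}"
    then have "(poly p t)\<^sup>2 \<le> e\<^sup>2" using assms[of t] \<open>0 \<le> e\<close>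
      by (intro iffD1[OF abs_le_square_iff]) auto
    then show "0 \<le> poly ([:e\<^sup>2:] - p * p) t" by (simp add: power2_eq_square)
  qed
  also have "\<dots> = (e * norm x)\<^sup>2 - (norm (poly_op p B x))\<^sup>2"
    using sym_poly[of p "poly_op p B x" x]
    by (simp add: poly_op_diff poly_op_pCons poly_op_mult blin rinner_simps rinner_self
        power_mult_distrib linear_0[OF bounded_linear.linear[OF blin]])
  finally show ?thesis using \<open>0 \<le> e\<close>
    by (intro power2_le_imp_le[of "norm (poly_op p B x)" "e * norm x"]) auto
qed

section \<open>Extension from polynomials to continuous functions by uniform limits\<close>

definition cfc :: "(real \<Rightarrow> real) \<Rightarrow> 'a \<Rightarrow> 'a" where
  "cfc f x = lim (\<lambda>n. poly_op
     ((SOME ps. uniform_limit {0..M} (\<lambda>n. poly (ps n)) f sequentially) n) B x)"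

lemma norm_poly_op_diff_le:
  assumes "\<And>t. t \<in> {0..M} \<Longrightarrow> \<bar>poly p t - poly q t\<bar> \<le> e"
  shows "norm (poly_op p B x - poly_op q B x) \<le> e * norm x"
  using norm_poly_op_le[of "p - q" e x] assms by (simp add: poly_op_diff)

text \<open>Used twice: with \<open>ps = qs\<close> it is the Cauchy property, and with different
  sequences it shows that they have the same limit.\<close>

lemma poly_op_limit_diff:
  assumes ps: "uniform_limit {0..M} (\<lambda>n. poly (ps n)) f sequentially"
    and qs: "uniform_limit {0..M} (\<lambda>n. poly (qs n)) f sequentially"
    and "e > 0"
  shows "\<exists>N. \<forall>m\<ge>N. \<forall>n\<ge>N. norm (poly_op (ps m) B x - poly_op (qs n) B x) < e"
proof -
  \<comment> \<open>The two errors add up to \<open>2 d\<close>; the summand 1 covers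
    \<open>x = 0\<close>.\<close>
  define d where "d = e / (2 * (norm x + 1))"
  have "d > 0" using \<open>e > 0\<close> by (simp add: d_def add_nonneg_pos)
  have "\<forall>\<^sub>F n in sequentially. \<forall>t\<in>{0..M}. dist (poly (ps n) t) (f t) < d"
       "\<forall>\<^sub>F n in sequentially. \<forall>t\<in>{0..M}. dist (poly (qs n) t) (f t) < d"
    using uniform_limitD[OF ps \<open>d > 0\<close>] uniform_limitD[OF qs \<open>d > 0\<close>] by auto
  then have "\<forall>\<^sub>F n in sequentially. \<forall>t\<in>{0..M}.
      dist (poly (ps n) t) (f t) < d \<and> dist (poly (qs n) t) (f t) < d"
    by eventually_elim auto
  then obtain N where N: "\<And>n t. n \<ge> N \<Longrightarrow> t \<in> {0..M} \<Longrightarrow>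
      dist (poly (ps n) t) (f t) < d \<and> dist (poly (qs n) t) (f t) < d"
    unfolding eventually_sequentially by blast
  have "norm (poly_op (ps m) B x - poly_op (qs n) B x) < e" if "m \<ge> N" "n \<ge> N" for m n
  proof -
    have "norm (poly_op (ps m) B x - poly_op (qs n) B x) \<le> (2 * d) * norm x"
    proof (rule norm_poly_op_diff_le)
      fix t assume "t \<in> {0..M}"
      then show "\<bar>poly (ps m) t - poly (qs n) t\<bar> \<le> 2 * d"
        using N[OF that(1), of t] N[OF that(2), of t] by (auto simp: dist_real_def)
    qed
    also have "\<dots> < (2 * d) * (norm x + 1)" using \<open>d > 0\<close> by simp
    also have "\<dots> = e" by (simp add: d_def field_simps add_nonneg_eq_0_iff)
    finally show ?thesis .
  qed
  then show ?thesis by blast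
qed

text \<open>The sequence picked by \<open>SOME\<close> inside \<open>cfc\<close> is immaterial: any
  other with the same uniform limit differs from it by a null sequence at each
  \<open>x\<close>.\<close>

lemma poly_op_tendsto_cfc:
  assumes "uniform_limit {0..M} (\<lambda>n. poly (ps n)) f sequentially"
  shows "(\<lambda>n. poly_op (ps n) B x) \<longlonglongrightarrow> cfc f x"
proof -
  define qs where "qs = (SOME ps. uniform_limit {0..M} (\<lambda>n. poly (ps n)) f sequentially)"
  have qs: "uniform_limit {0..M} (\<lambda>n. poly (qs n)) f sequentially"
    unfolding qs_def by (rule someI[of "\<lambda>ps. uniform_limit {0..M} (\<lambda>n. poly (ps n)) f sequentially", OF assms])
  have "Cauchy (\<lambda>n. poly_op (qs n) B x)"
    by (rule CauchyI) (use poly_op_limit_diff[OF qs qs] in auto)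
  then have "(\<lambda>n. poly_op (qs n) B x) \<longlonglongrightarrow> cfc f x"
    unfolding cfc_def qs_def[symmetric] by (simp add: Cauchy_convergent convergent_LIMSEQ_iff[symmetric])
  moreover have "(\<lambda>n. poly_op (ps n) B x - poly_op (qs n) B x) \<longlonglongrightarrow> 0"
    by (rule LIMSEQ_I) (use poly_op_limit_diff[OF assms qs] in fastforce)
  ultimately show ?thesis using tendsto_add by fastforce
qed

text \<open>The approximating sequences see only \<open>{0..M}\<close>, so identities for
  \<open>powr\<close> may be restricted to nonnegative arguments.\<close>

lemma cfc_cong:
  assumes "\<And>t. t \<in> {0..M} \<Longrightarrow> f t = g t"
  shows "cfc f = cfc g"
proof -
  have "uniform_limit {0..M} (\<lambda>n. poly (ps n)) f sequentially \<longleftrightarrow>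
      uniform_limit {0..M} (\<lambda>n. poly (ps n)) g sequentially" for ps :: "nat \<Rightarrow> real poly"
    by (rule uniform_limit_cong') (auto simp: assms)
  then show ?thesis by (simp add: cfc_def fun_eq_iff)
qed

lemma cfc_poly: "cfc (poly p) x = poly_op p B x"
  by (rule LIMSEQ_unique[OF poly_op_tendsto_cfc[OF uniform_limit_const] tendsto_const])

lemma cfc_const: "cfc (\<lambda>_. c) x = c *\<^sub>R x"
proof -
  have "cfc (\<lambda>_. c) = cfc (poly [:c:])" by (rule cfc_cong) simp
  then show ?thesis
    by (simp only: cfc_poly)
      (simp add: poly_op_pCons blin linear_0[OF bounded_linear.linear[OF blin]])
qed

lemma cfc_ident: "cfc (\<lambda>t. t) x = B x"
proof -
  have "cfc (\<lambda>t. t) = cfc (poly [:0, 1:])" by (rule cfc_cong) simp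
  then show ?thesis
    by (simp only: cfc_poly)
      (simp add: poly_op_pCons blin linear_0[OF bounded_linear.linear[OF blin]])
qed

section \<open>Algebra, order and norm estimates of the continuous calculus\<close>

lemma cfc_add:
  assumes "continuous_on {0..M} f" "continuous_on {0..M} g"
  shows "cfc (\<lambda>t. f t + g t) x = cfc f x + cfc g x"
proof -
  obtain ps where ps0: "uniform_limit {0..M} (\<lambda>n. poly (ps n)) f sequentially"
    using weierstrass_poly[OF assms(1)] by auto
  note ps = ps0 poly_op_tendsto_cfc[OF ps0]
  obtain qs where qs0: "uniform_limit {0..M} (\<lambda>n. poly (qs n)) g sequentially"
    using weierstrass_poly[OF assms(2)] by auto
  note qs = qs0 poly_op_tendsto_cfc[OF qs0]
  have "uniform_limit {0..M} (\<lambda>n. poly (ps n + qs n)) (\<lambda>t. f t + g t) sequentially"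
    using uniform_limit_add[OF ps(1) qs(1)] by (simp add: poly_add[abs_def])
  then have "(\<lambda>n. poly_op (ps n + qs n) B x) \<longlonglongrightarrow> cfc (\<lambda>t. f t + g t) x"
    by (rule poly_op_tendsto_cfc)
  moreover have "(\<lambda>n. poly_op (ps n + qs n) B x) \<longlonglongrightarrow> cfc f x + cfc g x"
    unfolding poly_op_add by (intro tendsto_add ps qs)
  ultimately show ?thesis by (rule LIMSEQ_unique)
qed

lemma bounded_on_interval:
  fixes f :: "real \<Rightarrow> real"
  assumes "continuous_on {0..M} f"
  shows "\<exists>K. \<forall>t\<in>{0..M}. \<bar>f t\<bar> \<le> K"
proof -
  have "bounded (f ` {0..M})"
    using assms by (intro compact_imp_bounded compact_continuous_image) auto
  then show ?thesis by (auto simp: bounded_iff)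
qed

lemma cfc_mult:
  assumes "continuous_on {0..M} f" "continuous_on {0..M} g"
  shows "cfc (\<lambda>t. f t * g t) x = cfc f (cfc g x)"
proof -
  obtain ps where ps0: "uniform_limit {0..M} (\<lambda>n. poly (ps n)) f sequentially"
    using weierstrass_poly[OF assms(1)] by auto
  note ps = ps0 poly_op_tendsto_cfc[OF ps0]
  obtain qs where qs0: "uniform_limit {0..M} (\<lambda>n. poly (qs n)) g sequentially"
    using weierstrass_poly[OF assms(2)] by auto
  note qs = qs0 poly_op_tendsto_cfc[OF qs0]
  have bdd: "bounded (f ` {0..M})" "bounded (g ` {0..M})"
    using assms by (auto intro!: compact_imp_bounded compact_continuous_image)
  have "uniform_limit {0..M} (\<lambda>n. poly (ps n * qs n)) (\<lambda>t. f t * g t) sequentially"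
    using uniform_lim_mult[OF ps(1) qs(1) bdd] by (simp add: poly_mult[abs_def])
  then have "(\<lambda>n. poly_op (ps n * qs n) B x) \<longlonglongrightarrow> cfc (\<lambda>t. f t * g t) x"
    by (rule poly_op_tendsto_cfc)
  moreover have "(\<lambda>n. poly_op (ps n * qs n) B x) \<longlonglongrightarrow> cfc f (cfc g x)"
  proof -
    \<comment> \<open>The operators \<open>poly_op (ps n) B\<close> are eventually bounded by
      \<open>K + 1\<close>, so the error in the inner argument still tends to 0 after applying
      them.\<close>
    obtain K where K: "\<And>t. t \<in> {0..M} \<Longrightarrow> \<bar>f t\<bar> \<le> K" using bounded_on_interval[OF assms(1)] by blast
    have "\<forall>\<^sub>F n in sequentially. \<forall>t\<in>{0..M}. dist (poly (ps n) t) (f t) < 1"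
      using uniform_limitD[OF ps(1), of 1] by simp
    then have "\<forall>\<^sub>F n in sequentially. norm (poly_op (ps n) B (poly_op (qs n) B x - cfc g x))
        \<le> (K + 1) * norm (poly_op (qs n) B x - cfc g x)"
    proof eventually_elim
      case (elim n)
      show ?case by (rule norm_poly_op_le) (use elim K in \<open>fastforce simp: dist_real_def\<close>)
    qed
    moreover have "(\<lambda>n. (K + 1) * norm (poly_op (qs n) B x - cfc g x)) \<longlonglongrightarrow> 0"
      using tendsto_mult_right_zero[OF tendsto_norm_zero[OF LIM_zero[OF qs(2)]]] .
    ultimately have "(\<lambda>n. poly_op (ps n) B (poly_op (qs n) B x - cfc g x)) \<longlonglongrightarrow> 0"
      by (rule Lim_null_comparison)
    then have "(\<lambda>n. poly_op (ps n) B (poly_op (qs n) B x - cfc g x) + poly_op (ps n) B (cfc g x))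
        \<longlonglongrightarrow> 0 + cfc f (cfc g x)"
      by (rule tendsto_add[OF _ ps(2)])
    then show ?thesis
      by (simp add: poly_op_mult blin linear_diff[OF bounded_linear.linear[OF blin_poly]])
  qed
  ultimately show ?thesis by (rule LIMSEQ_unique)
qed

lemma cfc_cmult:
  assumes "continuous_on {0..M} f"
  shows "cfc (\<lambda>t. c * f t) x = c *\<^sub>R cfc f x"
  using cfc_mult[of "\<lambda>_. c" f x] assms by (simp add: cfc_const continuous_on_const)

lemma cfc_diff:
  assumes "continuous_on {0..M} f" "continuous_on {0..M} g"
  shows "cfc (\<lambda>t. f t - g t) x = cfc f x - cfc g x"
  using cfc_add[OF assms(1) continuous_on_mult_left[OF assms(2)], of "-1" x]
    cfc_cmult[OF assms(2), of "-1" x] by simp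

lemma cfc_sum:
  assumes "\<And>i. i \<in> I \<Longrightarrow> continuous_on {0..M} (f i)"
  shows "cfc (\<lambda>t. \<Sum>i\<in>I. f i t) x = (\<Sum>i\<in>I. cfc (f i) x)"
  using assms
  by (induction I rule: infinite_finite_induct)
    (simp_all add: cfc_const cfc_add continuous_on_sum)

lemma cfc_sym:
  assumes "continuous_on {0..M} f"
  shows "rinner (cfc f x) y = rinner x (cfc f y)"
proof -
  obtain ps where "uniform_limit {0..M} (\<lambda>n. poly (ps n)) f sequentially"
    using weierstrass_poly[OF assms] by auto
  note ps = poly_op_tendsto_cfc[OF this]
  have "(\<lambda>n. rinner (poly_op (ps n) B x) y) \<longlonglongrightarrow> rinner (cfc f x) y"
    by (rule bounded_linear.tendsto[OF bounded_linear_rinner_left ps])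
  moreover have "(\<lambda>n. rinner (poly_op (ps n) B x) y) \<longlonglongrightarrow> rinner x (cfc f y)"
    using bounded_linear.tendsto[OF bounded_linear_rinner_left[of x] ps[of y]]
    by (simp add: sym_poly rinner_commute[of x])
  ultimately show ?thesis by (rule LIMSEQ_unique)
qed

text \<open>The approximating polynomials may exceed \<open>e\<close> by a small \<open>c\<close>,
  which is absorbed in an arbitrary slack.\<close>

lemma norm_cfc_le_bound:
  assumes "continuous_on {0..M} f" "\<And>t. t \<in> {0..M} \<Longrightarrow> \<bar>f t\<bar> \<le> e"
  shows "norm (cfc f x) \<le> e * norm x"
proof (rule field_le_epsilon)
  fix d :: real assume "d > 0"
  define c where "c = d / (norm x + 1)"
  have "c > 0" using \<open>d > 0\<close> by (simp add: c_def add_nonneg_pos)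
  obtain ps where ps0: "uniform_limit {0..M} (\<lambda>n. poly (ps n)) f sequentially"
    using weierstrass_poly[OF assms(1)] by auto
  note ps = ps0 poly_op_tendsto_cfc[OF ps0]
  have "\<forall>\<^sub>F n in sequentially. norm (poly_op (ps n) B x) \<le> (e + c) * norm x"
    using uniform_limitD[OF ps(1) \<open>c > 0\<close>]
  proof eventually_elim
    case (elim n)
    show ?case by (rule norm_poly_op_le) (use elim assms(2) in \<open>fastforce simp: dist_real_def\<close>)
  qed
  then have "norm (cfc f x) \<le> (e + c) * norm x"
    using tendsto_upperbound[OF tendsto_norm[OF ps(2)]] by simp
  also have "\<dots> \<le> e * norm x + c * (norm x + 1)" using \<open>c > 0\<close> by (simp add: algebra_simps)
  also have "\<dots> = e * norm x + d" by (simp add: c_def field_simps add_nonneg_eq_0_iff)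
  finally show "norm (cfc f x) \<le> e * norm x + d" .
qed

lemma norm_cfc_square:
  assumes "continuous_on {0..M} f"
  shows "(norm (cfc f x))\<^sup>2 = rinner (cfc (\<lambda>t. (f t)\<^sup>2) x) x"
  by (simp add: power2_eq_square cfc_mult assms cfc_sym flip: rinner_self[unfolded power2_eq_square])

text \<open>The form is the squared norm of \<open>sqrt(f)(B) x\<close>.\<close>

lemma cfc_nonneg:
  assumes "continuous_on {0..M} f" "\<And>t. t \<in> {0..M} \<Longrightarrow> 0 \<le> f t"
  shows "0 \<le> rinner (cfc f x) x"
proof -
  have "continuous_on {0..M} (\<lambda>t. sqrt (f t))" by (intro continuous_intros assms)
  from norm_cfc_square[OF this, of x]
  have "rinner (cfc (\<lambda>t. (sqrt (f t))\<^sup>2) x) x \<ge> 0" by (metis zero_le_power2)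
  also have "cfc (\<lambda>t. (sqrt (f t))\<^sup>2) = cfc f" by (rule cfc_cong) (simp add: assms)
  finally show ?thesis .
qed

lemma cfc_mono:
  assumes "continuous_on {0..M} f" "continuous_on {0..M} g" "\<And>t. t \<in> {0..M} \<Longrightarrow> f t \<le> g t"
  shows "rinner (cfc f x) x \<le> rinner (cfc g x) x"
  using cfc_nonneg[of "\<lambda>t. g t - f t" x] assms
  by (simp add: cfc_diff rinner_simps continuous_on_diff)

text \<open>A map that can be moved across the inner product is automatically linear.\<close>

lemma bounded_linear_cfc:
  assumes "continuous_on {0..M} f"
  shows "bounded_linear (cfc f)"
proof -
  obtain K where K: "\<And>t. t \<in> {0..M} \<Longrightarrow> \<bar>f t\<bar> \<le> K" using bounded_on_interval[OF assms] by blast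
  show ?thesis
  proof (rule bounded_linear_intro)
    show "cfc f (x + y) = cfc f x + cfc f y" for x y
      by (rule rinner_eqI) (simp add: cfc_sym[OF assms] rinner_simps)
    show "cfc f (c *\<^sub>R x) = c *\<^sub>R cfc f x" for c x
      by (rule rinner_eqI) (simp add: cfc_sym[OF assms] rinner_simps)
    show "norm (cfc f x) \<le> norm x * K" for x
      using norm_cfc_le_bound[OF assms K, of x] by (simp add: mult.commute)
  qed
qed

section \<open>Composition of functions and commutation with the calculus\<close>

lemma poly_op_cfc:
  assumes "continuous_on {0..M} g"
  shows "poly_op p (cfc g) x = cfc (\<lambda>t. poly p (g t)) x"
proof (induction p)
  case 0
  then show ?case by (simp add: cfc_const)
next
  case (pCons a p)
  have c: "continuous_on {0..M} (\<lambda>t. poly p (g t))" by (intro continuous_intros assms)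
  then show ?case using pCons.IH assms
    by (simp add: poly_op_pCons bounded_linear_cfc cfc_add cfc_mult cfc_const continuous_on_mult)
qed

text \<open>The set \<open>T\<close> contains the values of \<open>g\<close>, so
  \<open>p_n(g(t))\<close> tends to \<open>f(g(t))\<close> uniformly on \<open>{0..M}\<close>, and
  the norm estimate transfers this to operators.\<close>

lemma poly_op_cfc_tendsto:
  assumes g: "continuous_on {0..M} g" "\<And>t. t \<in> {0..M} \<Longrightarrow> g t \<in> T"
    and ps: "uniform_limit T (\<lambda>n. poly (ps n)) f sequentially" and f: "continuous_on T f"
  shows "(\<lambda>n. poly_op (ps n) (cfc g) x) \<longlonglongrightarrow> cfc (\<lambda>t. f (g t)) x"
proof (rule LIMSEQ_I)
  fix e :: real assume "e > 0"
  define d where "d = e / (norm x + 1)"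
  have "d > 0" using \<open>e > 0\<close> by (simp add: d_def add_nonneg_pos)
  have fg: "continuous_on {0..M} (\<lambda>t. f (g t))"
    by (rule continuous_on_compose2[OF f g(1)]) (use g(2) in auto)
  have "\<forall>\<^sub>F n in sequentially. norm (poly_op (ps n) (cfc g) x - cfc (\<lambda>t. f (g t)) x) < e"
    using uniform_limitD[OF ps \<open>d > 0\<close>]
  proof eventually_elim
    case (elim n)
    have c: "continuous_on {0..M} (\<lambda>t. poly (ps n) (g t))" by (intro continuous_intros g)
    have "norm (poly_op (ps n) (cfc g) x - cfc (\<lambda>t. f (g t)) x)
        = norm (cfc (\<lambda>t. poly (ps n) (g t) - f (g t)) x)"
      by (simp add: poly_op_cfc g cfc_diff c fg)
    also have "\<dots> \<le> d * norm x"
      by (rule norm_cfc_le_bound)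
        (use elim g(2) in \<open>auto intro!: continuous_on_diff c fg less_imp_le simp: dist_real_def\<close>)
    also have "\<dots> < d * (norm x + 1)" using \<open>d > 0\<close> by simp
    also have "\<dots> = e" by (simp add: d_def field_simps add_nonneg_eq_0_iff)
    finally show ?case .
  qed
  then show "\<exists>N. \<forall>n\<ge>N. norm (poly_op (ps n) (cfc g) x - cfc (\<lambda>t. f (g t)) x) < e"
    by (simp add: eventually_sequentially)
qed

text \<open>Whatever commutes with \<open>g(B)\<close> commutes with its polynomials and with their
  limits. For \<open>g\<close> a power and \<open>f\<close> its inverse this passes from a power of
  \<open>B\<close> back to \<open>B\<close>.\<close>

lemma cfc_compose_commute:
  assumes g: "continuous_on {0..M} g" "\<And>t. t \<in> {0..M} \<Longrightarrow> g t \<in> {0..L}"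
    and f: "continuous_on {0..L} f"
    and S: "bounded_linear S" "\<And>x. S (cfc g x) = cfc g (S x)"
  shows "S (cfc (\<lambda>t. f (g t)) x) = cfc (\<lambda>t. f (g t)) (S x)"
proof -
  obtain ps where ps: "uniform_limit {0..L} (\<lambda>n. poly (ps n)) f sequentially"
    using weierstrass_poly[OF f] by auto
  have "(\<lambda>n. S (poly_op (ps n) (cfc g) x)) \<longlonglongrightarrow> S (cfc (\<lambda>t. f (g t)) x)"
    by (intro bounded_linear.tendsto[OF S(1)] poly_op_cfc_tendsto[OF g ps f])
  moreover have "(\<lambda>n. S (poly_op (ps n) (cfc g) x)) \<longlonglongrightarrow> cfc (\<lambda>t. f (g t)) (S x)"
    unfolding poly_op_commute[OF bounded_linear_cfc[OF g(1)] S]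
    by (rule poly_op_cfc_tendsto[OF g ps f])
  ultimately show ?thesis by (rule LIMSEQ_unique)
qed

lemma cfc_commute:
  assumes "continuous_on {0..M} f" "bounded_linear S" "\<And>x. S (B x) = B (S x)"
  shows "S (cfc f x) = cfc f (S x)"
  using cfc_compose_commute[of "\<lambda>t. t" M f S x] assms by (simp add: cfc_ident)

text \<open>Multiplication by a complex scalar is a bounded real-linear map commuting with
  \<open>B\<close>, hence with \<open>f(B)\<close>; this is complex homogeneity.\<close>

lemma bounded_clinear_cfc:
  assumes "continuous_on {0..M} f"
  shows "bounded_clinear (cfc f)"
proof -
  interpret bounded_linear "cfc f" by (rule bounded_linear_cfc[OF assms])
  have norm_scaleC: "norm (scaleC c x) = cmod c * norm x" for c and x :: 'a
  proof -
    have "c * cnj c = (complex_of_real (cmod c))\<^sup>2" using complex_norm_square[of c] by (metis of_real_power)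
    then have "cinner (scaleC c x) (scaleC c x) = of_real ((cmod c)\<^sup>2) * cinner x x"
      by (simp add: cinner_scaleC_left cinner_commute[of x "scaleC c x"] mult_ac flip: cinner_commute[of x x])
    then show ?thesis by (simp add: norm_eq_sqrt_cinner real_sqrt_mult)
  qed
  have "cfc f (scaleC c x) = scaleC c (cfc f x)" for c x
  proof (rule cfc_commute[OF assms, symmetric])
    show "bounded_linear (scaleC c :: 'a \<Rightarrow> 'a)"
    proof (rule bounded_linear_intro)
      show "scaleC c (r *\<^sub>R x) = r *\<^sub>R scaleC c x" for r and x :: 'a
        by (simp add: scaleC_scaleC mult.commute flip: scaleC_of_real)
      show "norm (scaleC c x) \<le> norm x * cmod c" for x :: 'a by (simp add: norm_scaleC)
    qed (rule scaleC_add_right)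
    show "scaleC c (B x) = B (scaleC c x)" for x
      using positive by (simp add: positive_op_def bounded_clinear_def)
  qed
  then show ?thesis using bounded unfolding bounded_clinear_def by (metis add)
qed

text \<open>The norm estimate gives existence for the \<open>THE\<close>; for uniqueness, one
  Weierstrass sequence already fixes every value \<open>T x\<close>.\<close>

lemma op_pow_eq_cfc:
  assumes "s > 0"
  shows "op_pow B s = cfc (\<lambda>t. t powr s)"
proof -
  let ?f = "\<lambda>t::real. t powr s"
  have f: "continuous_on {0..M} ?f" by (rule continuous_on_powr_interval[OF assms])
  let ?conv = "\<lambda>ps :: nat \<Rightarrow> real poly. \<forall>e>0. \<forall>\<^sub>F n in sequentially. \<forall>t\<in>{0..M}.
      \<bar>poly (ps n) t - t powr s\<bar> < e"
  have onorm_conv: "(\<lambda>n. onorm (\<lambda>x. poly_op (ps n) B x - cfc ?f x)) \<longlonglongrightarrow> 0" if ps: "?conv ps" for ps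
  proof (rule LIMSEQ_I)
    fix e :: real assume "e > 0"
    then have "\<forall>\<^sub>F n in sequentially. \<forall>t\<in>{0..M}. \<bar>poly (ps n) t - t powr s\<bar> < e / 2"
      using ps half_gt_zero by blast
    then have "\<forall>\<^sub>F n in sequentially. norm (onorm (\<lambda>x. poly_op (ps n) B x - cfc ?f x) - 0) < e"
    proof eventually_elim
      case (elim n)
      have c: "continuous_on {0..M} (poly (ps n))" by (intro continuous_intros)
      have "norm (poly_op (ps n) B x - cfc ?f x) \<le> e / 2 * norm x" for x
        using norm_cfc_le_bound[OF continuous_on_diff[OF c f], of "e / 2" x] elim
        by (simp add: cfc_diff c f cfc_poly less_imp_le)
      then have "onorm (\<lambda>x. poly_op (ps n) B x - cfc ?f x) \<le> e / 2"
        using \<open>e > 0\<close> by (intro onorm_bound) auto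
      moreover have "0 \<le> onorm (\<lambda>x. poly_op (ps n) B x - cfc ?f x)"
        by (intro onorm_pos_le bounded_linear_sub blin_poly bounded_linear_cfc f)
      ultimately show ?case using \<open>e > 0\<close> by simp
    qed
    then show "\<exists>N. \<forall>n\<ge>N. norm (onorm (\<lambda>x. poly_op (ps n) B x - cfc ?f x) - 0) < e"
      by (simp add: eventually_sequentially)
  qed
  obtain ps where ps0: "uniform_limit {0..M} (\<lambda>n. poly (ps n)) ?f sequentially"
    using weierstrass_poly[OF f] by auto
  note ps = ps0 poly_op_tendsto_cfc[OF ps0]
  have "?conv ps" using uniform_limitD[OF ps(1)] by (simp add: dist_real_def)
  show ?thesis unfolding op_pow_def
  proof (rule the_equality)
    show "bounded_clinear (cfc ?f) \<and> (\<forall>ps. ?conv ps \<longrightarrow>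
        (\<lambda>n. onorm (\<lambda>x. poly_op (ps n) B x - cfc ?f x)) \<longlonglongrightarrow> 0)"
      using bounded_clinear_cfc[OF f] onorm_conv by blast
  next
    fix T :: "'a \<Rightarrow> 'a" assume T: "bounded_clinear T \<and> (\<forall>ps. ?conv ps \<longrightarrow>
        (\<lambda>n. onorm (\<lambda>x. poly_op (ps n) B x - T x)) \<longlonglongrightarrow> 0)"
    show "T = cfc ?f"
    proof
      fix x :: 'a
      have lim: "(\<lambda>n. onorm (\<lambda>x. poly_op (ps n) B x - T x) * norm x) \<longlonglongrightarrow> 0"
        using T \<open>?conv ps\<close> by (intro tendsto_mult_left_zero) blast
      have "bounded_linear (\<lambda>x. poly_op (ps n) B x - T x)" for n
        using T by (intro bounded_linear_sub blin_poly bounded_clinear_imp_bounded_linear) auto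
      then have "norm (poly_op (ps n) B x - T x) \<le> onorm (\<lambda>x. poly_op (ps n) B x - T x) * norm x" for n
        by (rule onorm)
      then have "(\<lambda>n. poly_op (ps n) B x - T x) \<longlonglongrightarrow> 0"
        by (intro Lim_null_comparison[OF _ lim] always_eventually) auto
      then have "(\<lambda>n. poly_op (ps n) B x) \<longlonglongrightarrow> T x" by (rule LIM_zero_cancel)
      then show "T x = cfc ?f x" using ps(2) by (rule LIMSEQ_unique)
    qed
  qed
qed


lemma norm_cfc_mono:
  assumes "continuous_on {0..M} f" "continuous_on {0..M} g"
    and "\<And>t. t \<in> {0..M} \<Longrightarrow> \<bar>f t\<bar> \<le> \<bar>g t\<bar>"
  shows "norm (cfc f x) \<le> norm (cfc g x)"
proof (rule power2_le_imp_le)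
  show "(norm (cfc f x))\<^sup>2 \<le> (norm (cfc g x))\<^sup>2"
    unfolding norm_cfc_square[OF assms(1)] norm_cfc_square[OF assms(2)]
    by (rule cfc_mono)
      (use assms(3) in \<open>auto intro!: continuous_on_power assms(1,2) iffD1[OF abs_le_square_iff]\<close>)
qed simp

lemma cfc_combination:
  assumes "continuous_on {0..M} f" "continuous_on {0..M} g" "continuous_on {0..M} k"
  shows "cfc (\<lambda>t. a * f t + b * g t + c * k t) x = a *\<^sub>R cfc f x + b *\<^sub>R cfc g x + c *\<^sub>R cfc k x"
proof -
  have "continuous_on {0..M} (\<lambda>t. a * f t)" "continuous_on {0..M} (\<lambda>t. b * g t)"
    "continuous_on {0..M} (\<lambda>t. c * k t)" "continuous_on {0..M} (\<lambda>t. a * f t + b * g t)"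
    by (intro continuous_intros assms)+
  then show ?thesis by (simp add: cfc_add cfc_cmult assms)
qed

section \<open>Commutation from domination\<close>

text \<open>Cut \<open>h\<close> into \<open>n + 1\<close> pieces \<open>d\<^sub>k(B) h\<close> on which \<open>y(B)\<close> is within \<open>\<epsilon> = L / n\<close> of the scalar
  \<open>k \<epsilon>\<close>. On each piece the commutator is \<open>O(\<epsilon>)\<close>. The pieces are almost orthogonal, so their norms
  sum to at most \<open>sqrt (n + 1) \<parallel>h\<parallel>\<close> and the total is \<open>O(sqrt \<epsilon>)\<close>.\<close>

lemma commute_cfc_of_dominated:
  assumes y: "continuous_on {0..M} y" "\<And>t. t \<in> {0..M} \<Longrightarrow> 0 \<le> y t \<and> y t \<le> L" and "L > 0"
    and A: "bounded_linear A" and "K \<ge> 0"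
    and dom: "\<And>s h. s \<ge> 0 \<Longrightarrow> norm (cfc y (A h) - s *\<^sub>R A h) \<le> K * norm (cfc y h - s *\<^sub>R h)"
  shows "A (cfc y h) = cfc y (A h)"
proof -
  interpret A: bounded_linear A by fact
  interpret Y: bounded_linear "cfc y" by (rule bounded_linear_cfc[OF y(1)])
  define K' where "K' = K + onorm A"
  have "K' \<ge> 0" using \<open>K \<ge> 0\<close> onorm_pos_le[OF A] by (simp add: K'_def)
  let ?C = "\<lambda>h. cfc y (A h) - A (cfc y h)"
  have bound: "(norm (?C h))\<^sup>2 \<le> (2 * (K' * L * norm h)\<^sup>2) / n" if "n > 0" for n :: nat
  proof -
    define e where "e = L / n"
    have "e > 0" using \<open>L > 0\<close> that by (simp add: e_def)
    \<comment> \<open>\<open>c k\<close> is a ramp that rises from 0 to 1 while \<open>y / e\<close>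
      runs from \<open>k - 1\<close> to \<open>k\<close>. The differences \<open>d k\<close> are hat
      functions centred at \<open>k\<close>, and they telescope to 1 because \<open>c 0 = 1\<close>
      and \<open>c (Suc n) = 0\<close> on \<open>{0..M}\<close>.\<close>
    define c where "c k t = max 0 (min 1 (y t / e - real k + 1))" for k t
    define d where "d k t = c k t - c (Suc k) t" for k t
    have cont_d: "continuous_on {0..M} (d k)" for k
      unfolding d_def c_def using \<open>e > 0\<close> by (intro continuous_intros y) auto
    have d01: "0 \<le> d k t" "d k t \<le> 1" for k t by (auto simp: d_def c_def)
    have d_local: "\<bar>(y t - real k * e) * d k t\<bar> \<le> \<bar>e * d k t\<bar>" for k t
    proof (cases "d k t = 0")
      case False
      then have "\<bar>y t / e - real k\<bar> \<le> 1" by (auto simp: d_def c_def max_def min_def split: if_splits)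
      then have "\<bar>y t - real k * e\<bar> \<le> e" using \<open>e > 0\<close> by (simp add: abs_le_iff field_simps)
      then show ?thesis using \<open>e > 0\<close> by (simp add: abs_mult mult_right_mono)
    qed simp
    have d_sum: "(\<Sum>k<Suc n. d k t) = 1" if t: "t \<in> {0..M}" for t
    proof -
      have "(\<Sum>k<Suc n. d k t) = c 0 t - c (Suc n) t"
        unfolding d_def by (rule sum_lessThan_telescope')
      moreover have "0 \<le> y t / e" "y t / e \<le> n"
        using y(2)[OF t] \<open>e > 0\<close> \<open>n > 0\<close> \<open>L > 0\<close> by (auto simp: e_def field_simps)
      ultimately show ?thesis by (simp add: c_def)
    qed
    define g where "g k = cfc (d k) h" for k
    have g_sum: "(\<Sum>k<Suc n. g k) = h"
    proof -
      have "(\<Sum>k<Suc n. g k) = cfc (\<lambda>t. \<Sum>k<Suc n. d k t) h"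
        unfolding g_def by (rule cfc_sum[symmetric]) (rule cont_d)
      also have "cfc (\<lambda>t. \<Sum>k<Suc n. d k t) = cfc (\<lambda>_. 1)" by (rule cfc_cong) (rule d_sum)
      finally show ?thesis by (simp add: cfc_const)
    qed
    have g_norms: "(\<Sum>k<Suc n. (norm (g k))\<^sup>2) \<le> (norm h)\<^sup>2"
    proof -
      have sq: "continuous_on {0..M} (\<lambda>t. (d k t)\<^sup>2)" for k by (intro continuous_intros cont_d)
      have "(\<Sum>k<Suc n. (norm (g k))\<^sup>2) = rinner (cfc (\<lambda>t. \<Sum>k<Suc n. (d k t)\<^sup>2) h) h"
        unfolding g_def norm_cfc_square[OF cont_d]
        by (subst cfc_sum) (auto simp: sq rinner_sum_left rinner_add_left)
      also have "\<dots> \<le> rinner (cfc (\<lambda>_. 1) h) h"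
      proof (rule cfc_mono)
        fix t assume t: "t \<in> {0..M}"
        \<comment> \<open>Almost orthogonality: the hats lie between 0 and 1, so their squares sum
          to at most 1.\<close>
        have "(\<Sum>k<Suc n. (d k t)\<^sup>2) \<le> (\<Sum>k<Suc n. d k t)"
          using d01 by (intro sum_mono) (simp add: power2_eq_square mult_left_le)
        then show "(\<Sum>k<Suc n. (d k t)\<^sup>2) \<le> 1" by (simp only: d_sum[OF t])
      qed (intro continuous_intros sq)+
      finally show ?thesis by (simp add: cfc_const rinner_self)
    qed
    have piece: "norm (?C (g k)) \<le> K' * e * norm (g k)" for k
    proof -
      let ?s = "real k * e"
      have "cfc y (g k) - ?s *\<^sub>R g k = cfc (\<lambda>t. (y t - ?s) * d k t) h"
        unfolding g_def using y(1) cont_d[of k]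
        by (simp add: cfc_mult cfc_diff cfc_const continuous_on_diff)
      then have small: "norm (cfc y (g k) - ?s *\<^sub>R g k) \<le> e * norm (g k)"
        using norm_cfc_mono[of "\<lambda>t. (y t - ?s) * d k t" "\<lambda>t. e * d k t" h] d_local \<open>e > 0\<close>
        by (simp add: g_def cfc_cmult cont_d y(1) continuous_on_mult continuous_on_diff)
      \<comment> \<open>The scalar \<open>?s\<close> commutes with \<open>A\<close>, so it may be
        subtracted in both terms of the commutator.\<close>
      have "?C (g k) = (cfc y (A (g k)) - ?s *\<^sub>R A (g k)) - A (cfc y (g k) - ?s *\<^sub>R g k)"
        by (simp add: A.diff A.scaleR)
      then have "norm (?C (g k)) \<le> norm (cfc y (A (g k)) - ?s *\<^sub>R A (g k)) + norm (A (cfc y (g k) - ?s *\<^sub>R g k))"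
        by (metis norm_triangle_ineq4)
      also have "\<dots> \<le> K * norm (cfc y (g k) - ?s *\<^sub>R g k) + onorm A * norm (cfc y (g k) - ?s *\<^sub>R g k)"
        using \<open>e > 0\<close> by (intro add_mono dom onorm[OF A]) simp
      also have "\<dots> = K' * norm (cfc y (g k) - ?s *\<^sub>R g k)" by (simp add: K'_def algebra_simps)
      also have "\<dots> \<le> K' * (e * norm (g k))" using small \<open>K' \<ge> 0\<close> by (rule mult_left_mono)
      finally show ?thesis by (simp add: mult.assoc)
    qed
    have "?C h = (\<Sum>k<Suc n. ?C (g k))"
      unfolding sum_subtractf A.sum[symmetric] Y.sum[symmetric] g_sum ..
    then have "norm (?C h) \<le> (\<Sum>k<Suc n. norm (?C (g k)))" by (metis norm_sum)
    also have "\<dots> \<le> (\<Sum>k<Suc n. K' * e * norm (g k))" by (intro sum_mono piece)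
    finally have "(norm (?C h))\<^sup>2 \<le> (\<Sum>k<Suc n. K' * e * norm (g k))\<^sup>2" by (intro power_mono) auto
    also have "\<dots> = (K' * e)\<^sup>2 * (\<Sum>k<Suc n. norm (g k))\<^sup>2"
      by (simp only: sum_distrib_left[symmetric] power_mult_distrib)
    also have "\<dots> \<le> (K' * e)\<^sup>2 * ((\<Sum>k<Suc n. (norm (g k))\<^sup>2) * card {..<Suc n})"
      by (intro mult_left_mono sum_squared_le_sum_of_squares) simp
    \<comment> \<open>Here \<open>n + 1 \<le> 2 n\<close>; with \<open>e = L / n\<close> one factor
      \<open>1 / n\<close> survives.\<close>
    also have "\<dots> \<le> (K' * e)\<^sup>2 * ((norm h)\<^sup>2 * (2 * n))"
      using \<open>n > 0\<close> g_norms by (intro mult_left_mono mult_mono) auto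
    also have "\<dots> = (2 * (K' * L * norm h)\<^sup>2) / n"
      using \<open>n > 0\<close> by (simp add: e_def field_simps power2_eq_square)
    finally show ?thesis .
  qed
  have "(\<lambda>n. (2 * (K' * L * norm h)\<^sup>2) / real n) \<longlonglongrightarrow> 0" by (rule lim_const_over_n)
  then have "(norm (?C h))\<^sup>2 \<le> 0"
    by (rule LIMSEQ_le_const) (use bound in \<open>auto intro!: exI[of _ 1]\<close>)
  then show ?thesis by simp
qed

end

section \<open>A two-sided Young inequality\<close>

text \<open>Weighted arithmetic-geometric mean. When \<open>a\<close> or \<open>b\<close> is 0 the
  left side vanishes by the convention \<open>0 powr x = 0\<close>, even for exponent 0.\<close>

lemma young_powr:
  fixes a b \<theta> :: real
  assumes "a \<ge> 0" "b \<ge> 0" "0 \<le> \<theta>" "\<theta> \<le> 1"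
  shows "a powr \<theta> * b powr (1 - \<theta>) \<le> \<theta> * a + (1 - \<theta>) * b"
proof (cases "a = 0 \<or> b = 0")
  case True
  then show ?thesis using assms by auto
next
  case False
  then show ?thesis using assms by (intro Youngs_inequality_0) auto
qed

text \<open>The differences between \<phi> and its two bounds are twice the gaps of two Young
  inequalities: one bounds the mixed term \<open>w\<close> by \<open>u s\<close> and
  \<open>s^2\<close>, the other bounds \<open>u s\<close> by \<open>w\<close> and
  \<open>u^2\<close>.\<close>

lemma young_gap_aux:
  fixes u s q :: real
  assumes "u \<ge> 0" "s \<ge> 0" "0 < q" "q \<le> 1"
  defines "\<phi> \<equiv> q * u\<^sup>2 - 2 * (s powr (2 - q) * u powr q) + (2 - q) * s\<^sup>2"
  shows "q * (u - s)\<^sup>2 \<le> \<phi>" "\<phi> \<le> (2 - q) * (u - s)\<^sup>2"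
proof -
  define w where "w = s powr (2 - q) * u powr q"
  have "w \<ge> 0" by (simp add: w_def)
  have 1: "w \<le> q * (u * s) + (1 - q) * s\<^sup>2"
  proof (cases "u = 0 \<or> s = 0")
    case True
    then show ?thesis using assms by (auto simp: w_def)
  next
    case False
    then have pos: "u > 0" "s > 0" using assms by auto
    have "(u * s) powr q * (s\<^sup>2) powr (1 - q) = u powr q * (s powr q * s powr (2 * (1 - q)))"
      using pos by (simp add: powr_mult powr_powr flip: powr_numeral)
    also have "s powr q * s powr (2 * (1 - q)) = s powr (2 - q)"
      by (simp flip: powr_add)
    finally show ?thesis using young_powr[of "u * s" "s\<^sup>2" q] assms by (simp add: w_def mult.commute)
  qed
  have 2: "(2 - q) * (u * s) \<le> w + (1 - q) * u\<^sup>2"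
  proof (cases "u = 0 \<or> s = 0")
    case True
    then show ?thesis using assms \<open>w \<ge> 0\<close> by auto
  next
    case False
    then have pos: "u > 0" "s > 0" using assms by auto
    \<comment> \<open>This weight gives \<open>s\<close> the exponent 1 in the mean of
      \<open>w\<close> and \<open>u^2\<close>; by \<open>ex\<close> the exponent of \<open>u\<close>
      is then 1 as well.\<close>
    define \<theta> where "\<theta> = 1 / (2 - q)"
    have \<theta>: "0 \<le> \<theta>" "\<theta> \<le> 1" "(2 - q) * \<theta> = 1" using assms by (auto simp: \<theta>_def)
    have ex: "q * \<theta> + 2 * (1 - \<theta>) = 1" using \<theta>(3) by (simp add: algebra_simps)
    have "w powr \<theta> * (u\<^sup>2) powr (1 - \<theta>) = s powr ((2 - q) * \<theta>) * (u powr (q * \<theta>) * u powr (2 * (1 - \<theta>)))"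
      using pos by (simp add: w_def powr_mult powr_powr flip: powr_numeral)
    also have "\<dots> = s * u" unfolding \<theta>(3) powr_add[symmetric] ex using pos by simp
    finally have "s * u \<le> \<theta> * w + (1 - \<theta>) * u\<^sup>2"
      using young_powr[of w "u\<^sup>2" \<theta>] \<theta> \<open>w \<ge> 0\<close> by simp
    then have "(2 - q) * (s * u) \<le> (2 - q) * (\<theta> * w + (1 - \<theta>) * u\<^sup>2)"
      using assms by (intro mult_left_mono) auto
    also have "\<dots> = ((2 - q) * \<theta>) * w + ((2 - q) - (2 - q) * \<theta>) * u\<^sup>2" by (simp add: algebra_simps)
    also have "\<dots> = w + (1 - q) * u\<^sup>2" by (simp add: \<theta>(3))
    finally show ?thesis by (simp add: mult.commute)
  qed
  show "q * (u - s)\<^sup>2 \<le> \<phi>" "\<phi> \<le> (2 - q) * (u - s)\<^sup>2"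
    using 1 2 unfolding \<phi>_def w_def[symmetric] by (simp_all add: power2_eq_square algebra_simps)
qed

text \<open>Exchanging \<open>u\<close> with \<open>s\<close> and \<open>q\<close> with
  \<open>2 - q\<close> leaves \<phi> unchanged, which reduces \<open>q > 1\<close> to the case
  already treated.\<close>

lemma young_gap:
  fixes u s q :: real
  assumes "u \<ge> 0" "s \<ge> 0" "0 < q" "q < 2"
  defines "\<phi> \<equiv> q * u\<^sup>2 - 2 * (s powr (2 - q) * u powr q) + (2 - q) * s\<^sup>2"
  shows "min q (2 - q) * (u - s)\<^sup>2 \<le> \<phi>" "\<phi> \<le> 2 * (u - s)\<^sup>2"
proof -
  have "min q (2 - q) * (u - s)\<^sup>2 \<le> \<phi> \<and> \<phi> \<le> max q (2 - q) * (u - s)\<^sup>2"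
  proof (cases "q \<le> 1")
    case True
    then show ?thesis using young_gap_aux[of u s q] assms by simp
  next
    case False
    then show ?thesis using young_gap_aux[of s u "2 - q"] assms
      by (simp add: power2_commute[of s u] algebra_simps)
  qed
  moreover have "max q (2 - q) * (u - s)\<^sup>2 \<le> 2 * (u - s)\<^sup>2"
    using assms by (intro mult_right_mono) auto
  ultimately show "min q (2 - q) * (u - s)\<^sup>2 \<le> \<phi>" "\<phi> \<le> 2 * (u - s)\<^sup>2" by auto
qed

section \<open>The equivalence\<close>

context pos_operator
begin

lemma dominated_of_power_equations:
  fixes A :: "'a \<Rightarrow> 'a" and \<alpha> \<beta> :: real
  assumes le: "\<And>h. (norm (A h))\<^sup>2 \<le> rinner (B h) h"
    and \<alpha>\<beta>: "0 < \<alpha>" "\<alpha> < \<beta>"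
    and eq: "\<And>p h. p \<in> {\<alpha>, \<beta>} \<Longrightarrow>
      rinner (cfc (\<lambda>t. t powr p) (A h)) (A h) = rinner (cfc (\<lambda>t. t powr (p + 1)) h) h"
  defines "Y \<equiv> cfc (\<lambda>t. t powr (\<beta> / 2))"
  shows "\<exists>K\<ge>0. \<forall>s\<ge>0. \<forall>h. norm (Y (A h) - s *\<^sub>R A h) \<le> K * norm (Y h - s *\<^sub>R h)"
proof -
  define y where "y t = t powr (\<beta> / 2)" for t :: real
  define q where "q = 2 * \<alpha> / \<beta>"
  have q: "0 < q" "q < 2" using \<alpha>\<beta> by (auto simp: q_def field_simps)
  define m where "m = min q (2 - q)"
  have "m > 0" using q by (simp add: m_def)
  have cy: "continuous_on {0..M} y"
    unfolding y_def using \<alpha>\<beta> by (intro continuous_on_powr_interval) simp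
  have cp: "continuous_on {0..M} (\<lambda>t. t powr p)" if "p > 0" for p
    by (rule continuous_on_powr_interval[OF that])
  have main: "m * (norm (Y (A h) - s *\<^sub>R A h))\<^sup>2 \<le> 2 * M * (norm (Y h - s *\<^sub>R h))\<^sup>2"
    if "s \<ge> 0" for s h
  proof -
    define r where "r = s powr (2 - q)"
    define c where "c = (2 - q) * s\<^sup>2"
    have "c \<ge> 0" using q by (simp add: c_def)
    \<comment> \<open>\<open>P t\<close> is the Young gap at \<open>u = y t\<close>, where
      \<open>u^2\<close> and \<open>u powr q\<close> become the powers \<beta> and \<alpha> of
      \<open>t\<close>. The factor \<open>c * 1\<close> matches the shape of
      \<open>cfc_combination\<close>.\<close>
    define P where "P t = q * t powr \<beta> + (- 2 * r) * t powr \<alpha> + c * 1" for t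
    have P: "P t = q * (y t)\<^sup>2 - 2 * (r * y t powr q) + c" if "t \<ge> 0" for t
    proof -
      have "(y t)\<^sup>2 = t powr \<beta>" unfolding y_def power2_eq_square by (simp flip: powr_add)
      moreover have "y t powr q = t powr \<alpha>" using \<alpha>\<beta> by (simp add: y_def powr_powr q_def)
      ultimately show ?thesis by (simp add: P_def)
    qed
    have P_bounds: "m * (y t - s)\<^sup>2 \<le> P t" "P t \<le> 2 * (y t - s)\<^sup>2" if "t \<ge> 0" for t
      using young_gap[of "y t" s q] q \<open>s \<ge> 0\<close> unfolding P[OF that] m_def r_def c_def
      by (simp_all add: y_def)
    have cP: "continuous_on {0..M} P"
      unfolding P_def using \<alpha>\<beta> by (intro continuous_intros cp) auto
    have cys: "continuous_on {0..M} (\<lambda>t. (y t - s)\<^sup>2)" by (intro continuous_intros cy)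
    have Ys: "(norm (Y x - s *\<^sub>R x))\<^sup>2 = rinner (cfc (\<lambda>t. (y t - s)\<^sup>2) x) x" for x
      using norm_cfc_square[of "\<lambda>t. y t - s" x]
      by (simp add: Y_def cfc_diff cfc_const cy continuous_on_diff flip: y_def)
    have "m * (norm (Y (A h) - s *\<^sub>R A h))\<^sup>2 = rinner (cfc (\<lambda>t. m * (y t - s)\<^sup>2) (A h)) (A h)"
      by (simp add: Ys cfc_cmult cys rinner_simps)
    also have "\<dots> \<le> rinner (cfc P (A h)) (A h)"
      by (rule cfc_mono) (auto intro!: continuous_on_mult_left cys cP P_bounds)
    also have "\<dots> = q * rinner (cfc (\<lambda>t. t powr \<beta>) (A h)) (A h)
        + (- 2 * r) * rinner (cfc (\<lambda>t. t powr \<alpha>) (A h)) (A h) + c * (norm (A h))\<^sup>2"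
      unfolding P_def using \<alpha>\<beta>
      by (subst cfc_combination) (auto simp: cp rinner_simps cfc_const rinner_self)
    \<comment> \<open>The two power terms are replaced by equality, which allows the negative
      coefficient \<open>- 2 * r\<close>; only the constant term uses an inequality, with
      \<open>c \<ge> 0\<close>.\<close>
    also have "\<dots> \<le> q * rinner (cfc (\<lambda>t. t powr (\<beta> + 1)) h) h
        + (- 2 * r) * rinner (cfc (\<lambda>t. t powr (\<alpha> + 1)) h) h + c * rinner (B h) h"
      using le[of h] \<open>c \<ge> 0\<close> by (simp add: eq mult_left_mono)
    also have "\<dots> = rinner (cfc (\<lambda>t. q * t powr (\<beta> + 1) + (- 2 * r) * t powr (\<alpha> + 1) + c * t) h) h"
      using \<alpha>\<beta> by (subst cfc_combination) (auto simp: cp rinner_simps cfc_ident)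
    also have "\<dots> \<le> rinner (cfc (\<lambda>t. 2 * M * (y t - s)\<^sup>2) h) h"
    proof (rule cfc_mono)
      fix t assume t: "t \<in> {0..M}"
      then have "q * t powr (\<beta> + 1) + (- 2 * r) * t powr (\<alpha> + 1) + c * t = t * P t"
        by (simp add: P_def powr_add algebra_simps)
      also have "\<dots> \<le> t * (2 * (y t - s)\<^sup>2)" using t P_bounds(2)[of t] by (intro mult_left_mono) auto
      also have "\<dots> \<le> M * (2 * (y t - s)\<^sup>2)" using t by (intro mult_right_mono) auto
      finally show "q * t powr (\<beta> + 1) + (- 2 * r) * t powr (\<alpha> + 1) + c * t \<le> 2 * M * (y t - s)\<^sup>2"
        by (simp add: mult_ac)
    qed (use \<alpha>\<beta> in \<open>intro continuous_intros cp cy; simp\<close>)+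
    also have "\<dots> = 2 * M * (norm (Y h - s *\<^sub>R h))\<^sup>2"
      by (simp add: Ys cfc_cmult cys rinner_simps)
    finally show ?thesis .
  qed
  define K where "K = sqrt (2 * M / m)"
  have "K \<ge> 0" using M_nonneg \<open>m > 0\<close> by (simp add: K_def)
  have "norm (Y (A h) - s *\<^sub>R A h) \<le> K * norm (Y h - s *\<^sub>R h)" if "s \<ge> 0" for s h
  proof (rule power2_le_imp_le)
    show "(norm (Y (A h) - s *\<^sub>R A h))\<^sup>2 \<le> (K * norm (Y h - s *\<^sub>R h))\<^sup>2"
      using main[OF that, of h] \<open>m > 0\<close> M_nonneg
      by (simp add: K_def power_mult_distrib field_simps)
  qed (simp add: \<open>K \<ge> 0\<close>)
  then show ?thesis using \<open>K \<ge> 0\<close> by blast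
qed

lemma quasinormal_of_power_equations:
  fixes A :: "'a \<Rightarrow> 'a" and \<alpha> \<beta> :: real
  assumes A: "bounded_clinear A" and le: "op_le (adj A \<circ> A) B"
    and \<alpha>\<beta>: "0 < \<alpha>" "\<alpha> < \<beta>"
    and eq: "\<And>p. p \<in> {\<alpha>, \<beta>} \<Longrightarrow> adj A \<circ> op_pow B p \<circ> A = op_pow B (p + 1)"
  shows "quasinormal A \<and> B = adj A \<circ> A"
proof -
  note blA = bounded_clinear_imp_bounded_linear[OF A]
  define y where "y t = t powr (\<beta> / 2)" for t :: real
  define Y where "Y = cfc y"
  \<comment> \<open>The summand 1 keeps \<open>L\<close> positive when \<open>B = 0\<close>.\<close>
  define L where "L = M powr (\<beta> / 2) + 1"
  have cy: "continuous_on {0..M} y"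
    unfolding y_def using \<alpha>\<beta> by (intro continuous_on_powr_interval) simp
  have yL: "0 \<le> y t \<and> y t \<le> L" if "t \<in> {0..M}" for t
    using that \<alpha>\<beta> powr_mono2[of "\<beta> / 2" t M] by (simp add: y_def L_def)
  have "L > 0" by (simp add: L_def add_nonneg_pos)
  have eq': "adj A (cfc (\<lambda>t. t powr p) (A h)) = cfc (\<lambda>t. t powr (p + 1)) h"
    if "p \<in> {\<alpha>, \<beta>}" for p h
    using fun_cong[OF eq[OF that], of h] that \<alpha>\<beta>
    by (auto simp: op_pow_eq_cfc)
  have le': "(norm (A h))\<^sup>2 \<le> rinner (B h) h" for h
  proof -
    have "0 \<le> rinner (B h - adj A (A h)) h"
      using le by (auto simp: op_le_def positive_op_def rinner_def)
    then show ?thesis by (simp add: rinner_simps rinner_adj[OF A] rinner_self)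
  qed
  have "rinner (cfc (\<lambda>t. t powr p) (A h)) (A h) = rinner (cfc (\<lambda>t. t powr (p + 1)) h) h"
    if "p \<in> {\<alpha>, \<beta>}" for p h
    by (simp only: rinner_adj(2)[OF A, symmetric] eq'[OF that])
  from dominated_of_power_equations[OF le' \<alpha>\<beta> this] obtain K where K: "K \<ge> 0"
    "\<And>s h. s \<ge> 0 \<Longrightarrow> norm (Y (A h) - s *\<^sub>R A h) \<le> K * norm (Y h - s *\<^sub>R h)"
    unfolding Y_def y_def by blast
  have AY: "A (Y h) = Y (A h)" for h
    unfolding Y_def
    by (rule commute_cfc_of_dominated[OF cy yL \<open>L > 0\<close> blA K[unfolded Y_def]])
  define f where "f u = u powr (2 / \<beta>)" for u :: real
  have cf: "continuous_on {0..L} f"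
    unfolding f_def using \<alpha>\<beta> by (intro continuous_on_powr_interval) simp
  have fy: "cfc (\<lambda>t. f (y t)) x = B x" for x
  proof -
    have "cfc (\<lambda>t. f (y t)) = cfc (\<lambda>t. t)"
      using \<alpha>\<beta> by (intro cfc_cong) (simp add: f_def y_def powr_powr)
    then show ?thesis by (simp add: cfc_ident)
  qed
  have AB: "A (B x) = B (A x)" for x
    using cfc_compose_commute[OF cy _ cf blA, of x] yL AY by (simp add: fy Y_def)
  define D where "D x = B x - adj A (A x)" for x
  have D_sym: "rinner (D x) z = rinner x (D z)" for x z
    by (simp add: D_def rinner_simps sym rinner_adj[OF A])
  have Y_sym: "rinner (Y x) z = rinner x (Y z)" for x z unfolding Y_def by (rule cfc_sym[OF cy])
  have YY: "Y (Y x) = cfc (\<lambda>t. t powr \<beta>) x" for x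
  proof -
    have "Y (Y x) = cfc (\<lambda>t. y t * y t) x" unfolding Y_def by (rule cfc_mult[OF cy cy, symmetric])
    also have "(\<lambda>t. y t * y t) = (\<lambda>t. t powr \<beta>)" by (simp add: y_def flip: powr_add)
    finally show ?thesis .
  qed
  \<comment> \<open>Since \<open>A\<close> commutes with \<open>Y\<close>, the equation for \<beta>
    says that \<open>A* A\<close> and \<open>B\<close> agree on the range of
    \<open>Y^2\<close>.\<close>
  have DYY: "D (Y (Y x)) = 0" for x
  proof -
    have "adj A (A (Y (Y x))) = cfc (\<lambda>t. t powr (\<beta> + 1)) x"
      using eq'[of \<beta> x] by (simp add: AY flip: YY)
    also have "cfc (\<lambda>t. t powr (\<beta> + 1)) = cfc (\<lambda>t. t * t powr \<beta>)"
      by (rule cfc_cong) (simp add: powr_add mult.commute)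
    also have "cfc (\<lambda>t. t * t powr \<beta>) x = B (Y (Y x))"
      using \<alpha>\<beta> by (subst cfc_mult) (auto intro!: continuous_on_powr_interval simp: cfc_ident YY)
    finally show ?thesis by (simp add: D_def)
  qed
  \<comment> \<open>Taking adjoints gives \<open>Y^2 D = 0\<close>, and the squared norm of
    \<open>Y (D x)\<close> is the form of \<open>Y^2\<close> at \<open>D x\<close>.\<close>
  have YD: "Y (D x) = 0" for x
  proof -
    have "rinner (Y (Y (D x))) z = rinner 0 z" for z
      using DYY[of z] by (simp add: Y_sym D_sym)
    then have "Y (Y (D x)) = 0" by (rule rinner_eqI)
    then have "rinner (Y (D x)) (Y (D x)) = 0" by (simp flip: Y_sym)
    then show ?thesis by (simp add: rinner_self)
  qed
  \<comment> \<open>\<open>B\<close> is a limit of polynomials of \<open>Y\<close>, which act on the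
    kernel of \<open>Y\<close> as their values at 0; the limit of these is
    \<open>f 0 = 0\<close>.\<close>
  have BD: "B (D x) = 0" for x
  proof -
    note blY = bounded_linear_cfc[OF cy, folded Y_def]
    obtain ps where ps: "uniform_limit {0..L} (\<lambda>n. poly (ps n)) f sequentially"
      using weierstrass_poly[OF cf] by auto
    have "(\<lambda>n. poly_op (ps n) Y (D x)) \<longlonglongrightarrow> B (D x)"
      using poly_op_cfc_tendsto[OF cy _ ps cf, of "D x"] yL by (simp add: fy Y_def)
    moreover have "poly_op p Y (D x) = poly p 0 *\<^sub>R D x" for p
    proof (induction p)
      case (pCons a p)
      then show ?case using YD[of x] blY
        by (simp add: poly_op_pCons linear_scale[OF bounded_linear.linear[OF blY]])
    qed simp
    moreover have "(\<lambda>n. poly (ps n) 0 *\<^sub>R D x) \<longlonglongrightarrow> f 0 *\<^sub>R D x"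
      using \<open>L > 0\<close> by (intro tendsto_intros tendsto_uniform_limitI[OF ps]) simp
    ultimately have "B (D x) = f 0 *\<^sub>R D x" by (metis (no_types, lifting) LIMSEQ_unique ext)
    then show ?thesis by (simp add: f_def)
  qed
  have "D x = 0" for x
  proof -
    have "A (D x) = 0" using le'[of "D x"] by (simp add: BD)
    moreover have "adj A 0 = 0" by (rule rinner_eqI) (simp add: rinner_adj(2)[OF A])
    ultimately have "D (D x) = 0" by (simp add: D_def[of "D x"] BD)
    then have "rinner (D x) (D x) = 0" using D_sym[of "D x" x] by simp
    then show ?thesis by (simp add: rinner_self)
  qed
  then have "B = adj A \<circ> A" by (auto simp: D_def)
  moreover from this AB have "quasinormal A" by (auto simp: quasinormal_def fun_eq_iff)
  ultimately show ?thesis by simp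
qed

text \<open>Quasinormality now says that \<open>A\<close> commutes with \<open>B\<close>, hence with
  its powers; moving \<open>A\<close> to the left leaves \<open>A* A = B\<close> times a power of
  \<open>B\<close>.\<close>

lemma power_equation_of_quasinormal:
  assumes A: "bounded_clinear A" and "quasinormal A" and "B = adj A \<circ> A" and "p > 0"
  shows "adj A \<circ> op_pow B p \<circ> A = op_pow B (p + 1)"
proof
  fix x
  have AB: "A (B x) = B (A x)" for x
    using assms(2,3) by (simp add: quasinormal_def fun_eq_iff)
  have cp: "continuous_on {0..M} (\<lambda>t. t powr p)" by (rule continuous_on_powr_interval[OF \<open>p > 0\<close>])
  have "adj A (cfc (\<lambda>t. t powr p) (A x)) = adj A (A (cfc (\<lambda>t. t powr p) x))"
    by (simp add: cfc_commute[OF cp bounded_clinear_imp_bounded_linear[OF A] AB])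
  also have "\<dots> = B (cfc (\<lambda>t. t powr p) x)" using fun_cong[OF assms(3)] by simp
  also have "\<dots> = cfc (\<lambda>t. t * t powr p) x"
    by (subst cfc_mult) (auto intro: cp simp: cfc_ident)
  also have "cfc (\<lambda>t. t * t powr p) = cfc (\<lambda>t. t powr (p + 1))"
    by (rule cfc_cong) (simp add: powr_add mult.commute)
  finally show "(adj A \<circ> op_pow B p \<circ> A) x = op_pow B (p + 1) x"
    using \<open>p > 0\<close> by (simp add: op_pow_eq_cfc)
qed

end

theorem theorem1p6:
  fixes A B :: "'a::chilbert_space \<Rightarrow> 'a" and \<alpha> \<beta> :: real
  assumes "bounded_clinear A" and "positive_op B"
    and "\<alpha> > 0" and "\<beta> > 0" and "\<alpha> \<noteq> \<beta>"
  shows "(op_le (adj A \<circ> A) B \<and>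
          (\<forall>s\<in>{\<alpha>, \<beta>}. adj A \<circ> op_pow B s \<circ> A = op_pow B (s + 1)))
     \<longleftrightarrow> (quasinormal A \<and> B = adj A \<circ> A)"
proof -
  interpret pos_operator B by unfold_locales fact
  show ?thesis
  proof
    assume *: "op_le (adj A \<circ> A) B \<and>
        (\<forall>s\<in>{\<alpha>, \<beta>}. adj A \<circ> op_pow B s \<circ> A = op_pow B (s + 1))"
    show "quasinormal A \<and> B = adj A \<circ> A"
      \<comment> \<open>The hypotheses are symmetric in the two exponents, so they may be
        ordered.\<close>
      by (rule quasinormal_of_power_equations[OF assms(1), of "min \<alpha> \<beta>" "max \<alpha> \<beta>"])
        (use assms * in \<open>auto simp: min_def max_def split: if_splits\<close>)
  next
    assume *: "quasinormal A \<and> B = adj A \<circ> A"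
    have "positive_op (\<lambda>x::'a. 0)"
    proof -
      have "scaleC c (0::'a) = 0" for c by (metis add_cancel_right_right scaleC_add_right)
      moreover have "cinner (0::'a) x = 0" for x
        by (metis add_cancel_right_right cinner_add_left)
      ultimately show ?thesis
        by (auto simp: positive_op_def bounded_clinear_def intro!: exI[of _ 0])
    qed
    then have "op_le (adj A \<circ> A) B" using * by (simp add: op_le_def fun_eq_iff)
    then show "op_le (adj A \<circ> A) B \<and>
        (\<forall>s\<in>{\<alpha>, \<beta>}. adj A \<circ> op_pow B s \<circ> A = op_pow B (s + 1))"
      using * assms power_equation_of_quasinormal[OF assms(1)] by auto
  qed
qed

end
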